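(* Let $X\in\mathbb{R}^{m\times n}$, $m\ge n$, have full column rank, with $mn\mathbf{u}\le\frac1{64}$ and $n(n+1)\mathbf{u}\le\frac1{64}$. Let $s=11(mn\mathbf{u}+n(n+1)\mathbf{u})[X]_g^2$, where $s\le\frac1{100}[X]_g^2$, and suppose $$\kappa_2(X)\le\frac{1}{86\,p\,(mn\mathbf{u}+n(n+1)\mathbf{u})}\ \left(\le\frac{1}{4.89\,p\,n^2\mathbf{u}}\right).$$ Let $Q_2$ and $R_4$ be the factors computed in floating-point arithmetic by the improved Shifted CholeskyQR3 algorithm applied to $X$ with shift $s$. Then $$\|Q_2^\top Q_2-I\|_F\le 6(mn\mathbf{u}+n(n+1)\mathbf{u}),\qquad \|Q_2R_4-X\|_F\le(6.57\,p+4.87)\,n^2\mathbf{u}\,\|X\|_2 .$$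
   Context: $\mathbf{u}=2^{-53}$ is the unit roundoff. $\|\cdot\|_2$, $\|\cdot\|_F$ are the spectral and Frobenius norms, $\sigma_1(X)\ge\dots\ge\sigma_n(X)$ the singular values, $\kappa_2(X)=\sigma_1(X)/\sigma_n(X)$. For a matrix $X$ with columns $X_1,\dots,X_n$, $[X]_g:=\max_{1\le j\le n}\|X_j\|_2$, and $p:=[X]_g/\|X\|_2$ (so $1/\sqrt n\le p\le1$). $|A|$ denotes the entrywise absolute value, inequalities between matrices are entrywise, and $\gamma_k:=\frac{k\mathbf{u}}{1-k\mathbf{u}}$, for which the bound $\gamma_k\le1.02k\mathbf{u}$ is used. Improved Shifted CholeskyQR3 with shift $s$ computes: (1) $B=X^\top X$, $R=\mathrm{Cholesky}(B+sI)$, $Q=XR^{-1}$; (2) $C=Q^\top Q$, $R_1=\mathrm{Cholesky}(C)$, $Q_1=QR_1^{-1}$, $R_2=R_1R$; (3) $C_1=Q_1^\top Q_1$, $R_3=\mathrm{Cholesky}(C_1)$, $Q_2=Q_1R_3^{-1}$, $R_4=R_3R_2$. All Cholesky factors are upper triangular. In floating-point arithmetic (standard model) the computed quantities satisfy: - $B=X^\top X+E_A$, $|E_A|\le\gamma_m|X^\top||X|$; $R^\top R=B+sI+E_B$, $|E_B|\le\gamma_{n+1}|R^\top||R|$; for each row $i$, $q_i^\top=x_i^\top(R+E_{Ri})^{-1}$ with $|E_{Ri}|\le\gamma_n|R|$; - $C=Q^\top Q+E_1$, $|E_1|\le\gamma_m|Q^\top||Q|$; $R_1^\top R_1=C+E_2$,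 $|E_2|\le\gamma_{n+1}|R_1^\top||R_1|$; for each row $i$, $q_{1i}^\top=q_i^\top(R_1+E_{R1i})^{-1}$ with $|E_{R1i}|\le\gamma_n|R_1|$; $R_2=R_1R-E_4$, $|E_4|\le\gamma_n|R_1||R|$; - $C_1=Q_1^\top Q_1+E_5$, $|E_5|\le\gamma_m|Q_1^\top||Q_1|$; $R_3^\top R_3=C_1+E_6$, $|E_6|\le\gamma_{n+1}|R_3^\top||R_3|$; for each row $i$, $q_{2i}^\top=q_{1i}^\top(R_3+E_{R3i})^{-1}$ with $|E_{R3i}|\le\gamma_n|R_3|$; $R_4=R_3R_2-E_8$, $|E_8|\le\gamma_n|R_3||R_2|$. Here $x_i^\top,q_i^\top,q_{1i}^\top,q_{2i}^\top$ are the $i$-th rows of $X,Q,Q_1,Q_2$. *)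

theory Defs
  imports "HOL-Analysis.Analysis"
begin

text \<open>
  Matrices with \<open>m\<close> rows and \<open>n\<close> columns have type \<open>real^'n^'m\<close>. On this type the
  library's \<open>\<bar>_\<bar>\<close> and \<open>\<le>\<close> are entrywise, as all matrix bounds below require, and
  its \<open>norm\<close> is the Frobenius norm.
\<close>

abbreviation frobenius_norm :: "real^'n^'m \<Rightarrow> real" where
  "frobenius_norm A \<equiv> norm A"

lemma frobenius_norm_eq: "frobenius_norm A = sqrt (\<Sum>i\<in>UNIV. \<Sum>j\<in>UNIV. (A $ i $ j)\<^sup>2)"
  by (simp add: norm_vec_def L2_set_def sum_nonneg)

definition spectral_norm :: "real^'n^'m \<Rightarrow> real" where
  "spectral_norm A = onorm ((*v) A)"

text \<open>
  Square roots of the eigenvalues of \<open>A\<^sup>T A\<close>. This is the set of the numbers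
  \<open>\<sigma>\<^sub>1 \<ge> \<dots> \<ge> \<sigma>\<^sub>n\<close> when \<open>m \<ge> n\<close> (for \<open>m < n\<close> it also contains 0). It is finite and
  nonempty, so that \<open>Max\<close> and \<open>Min\<close> select \<open>\<sigma>\<^sub>1\<close> and \<open>\<sigma>\<^sub>n\<close>.
\<close>

definition singular_values :: "real^'n^'m \<Rightarrow> real set" where
  "singular_values A =
     {\<sigma>. 0 \<le> \<sigma> \<and> (\<exists>v. v \<noteq> 0 \<and> (transpose A ** A) *v v = \<sigma>\<^sup>2 *\<^sub>R v)}"

definition cond2 :: "real^'n^'m \<Rightarrow> real" where
  "cond2 A = Max (singular_values A) / Min (singular_values A)"

definition max_col_norm :: "real^'n^'m \<Rightarrow> real" where
  "max_col_norm A = Max (range (\<lambda>j. norm (column j A)))"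

definition unit_roundoff :: real where
  "unit_roundoff = 1 / 2 ^ 53"

definition fl_gamma :: "nat \<Rightarrow> real" where
  "fl_gamma k = real k * unit_roundoff / (1 - real k * unit_roundoff)"

definition upper_triangular :: "real^('n::{finite,linorder})^('n::{finite,linorder}) \<Rightarrow> bool" where
  "upper_triangular A \<longleftrightarrow> (\<forall>i j. j < i \<longrightarrow> A $ i $ j = 0)"

text \<open>
  Each \<open>fl_\<close> predicate is the backward error relation that the standard model of
  floating-point arithmetic gives for one operation, its last argument being the computed result.
  For \<open>fl_cholesky\<close>, \<open>R\<close> factors the exact sum \<open>B + s I\<close> in the first step of the
  algorithm; rounding in the shift is part of the Cholesky error. No sign is prescribed for the
  diagonal of \<open>R\<close>. In \<open>fl_right_solve\<close> the perturbation depends on the row.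
\<close>

definition fl_gram :: "real^'n^'m \<Rightarrow> real^'n^'n \<Rightarrow> bool" where
  "fl_gram X B \<longleftrightarrow>
     (\<exists>E. B = transpose X ** X + E \<and> \<bar>E\<bar> \<le> fl_gamma CARD('m) *\<^sub>R (transpose \<bar>X\<bar> ** \<bar>X\<bar>))"

definition fl_cholesky :: "real^('n::{finite,linorder})^('n::{finite,linorder}) \<Rightarrow> real^('n::{finite,linorder})^('n::{finite,linorder}) \<Rightarrow> bool" where
  "fl_cholesky A R \<longleftrightarrow> upper_triangular R \<and>
     (\<exists>E. transpose R ** R = A + E \<and>
          \<bar>E\<bar> \<le> fl_gamma (CARD('n) + 1) *\<^sub>R (transpose \<bar>R\<bar> ** \<bar>R\<bar>))"

definition fl_right_solve :: "real^'n^'m \<Rightarrow> real^'n^'n \<Rightarrow> real^'n^'m \<Rightarrow> bool" where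
  "fl_right_solve X R Q \<longleftrightarrow>
     (\<forall>i. \<exists>E. \<bar>E\<bar> \<le> fl_gamma CARD('n) *\<^sub>R \<bar>R\<bar> \<and> invertible (R + E) \<and>
              row i Q = row i X v* matrix_inv (R + E))"

definition fl_mult :: "real^'n^'n \<Rightarrow> real^'n^'n \<Rightarrow> real^'n^'n \<Rightarrow> bool" where
  "fl_mult A B P \<longleftrightarrow>
     (\<exists>E. P = A ** B - E \<and> \<bar>E\<bar> \<le> fl_gamma CARD('n) *\<^sub>R (\<bar>A\<bar> ** \<bar>B\<bar>))"

definition improved_SCholeskyQR3 ::
    "real \<Rightarrow> real^('n::{finite,linorder})^'m \<Rightarrow> real^('n::{finite,linorder})^'m \<Rightarrow> real^('n::{finite,linorder})^('n::{finite,linorder}) \<Rightarrow> bool" where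
  "improved_SCholeskyQR3 s X Q2 R4 \<longleftrightarrow>
     (\<exists>B R Q C R1 Q1 R2 C1 R3.
        fl_gram X B \<and> fl_cholesky (B + s *\<^sub>R mat 1) R \<and> fl_right_solve X R Q \<and>
        fl_gram Q C \<and> fl_cholesky C R1 \<and> fl_right_solve Q R1 Q1 \<and> fl_mult R1 R R2 \<and>
        fl_gram Q1 C1 \<and> fl_cholesky C1 R3 \<and> fl_right_solve Q1 R3 Q2 \<and> fl_mult R3 R2 R4)"

end

theory Submission
  imports Defs
begin

text \<open>
  One CholeskyQR step turns \<open>A\<close> into \<open>Q\<close> with \<open>R\<^sup>T R = A\<^sup>T A + s I + E\<close> and \<open>Q R = A - W\<close>,
  where \<open>E\<close> and \<open>W\<close> are small. If \<open>\<rho>\<close> bounds the gain \<open>\<parallel>R z\<parallel> / \<parallel>z\<parallel>\<close> from below, the substitution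
  \<open>y = R z\<close> bounds \<open>\<parallel>Q y\<parallel>\<close> from both sides in terms of \<open>\<parallel>A z\<parallel> / \<parallel>R z\<parallel>\<close> and \<open>\<parallel>W\<parallel> / \<rho>\<close>.
  Let \<open>\<epsilon> = m n u + n (n + 1) u\<close>. The shift makes \<open>\<rho>\<close> of order \<open>\<surd>\<epsilon> [X]\<^sub>g\<close> in the first step, and with
  the bound on the condition number the smallest singular value of \<open>Q\<close> is at least \<open>19.6 \<surd>\<epsilon>\<close>.
  This suffices for the second step to give singular values within \<open>0.3\<close> percent of 1. The third step
  then has \<open>\<rho>\<close> close to 1, so that its defect of orthogonality is of the order of \<open>E\<close> and \<open>W\<close>,
  that is of \<open>\<epsilon>\<close>. The residual is the sum of the errors of the five multiplications and solves,
  each propagated through factors of known norm.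
\<close>

subsection \<open>Matrix norms\<close>

lemma norm_mult_vec_le_spectral_norm: "norm (A *v x) \<le> spectral_norm A * norm x"
  for A :: "real^'n^'m"
  unfolding spectral_norm_def by (rule onorm) simp

lemma spectral_norm_nonneg: "0 \<le> spectral_norm A"
  for A :: "real^'n^'m"
  unfolding spectral_norm_def by (rule onorm_pos_le) simp

lemma spectral_norm_leI: "(\<And>x. norm (A *v x) \<le> c * norm x) \<Longrightarrow> spectral_norm A \<le> c"
  for A :: "real^'n^'m"
  unfolding spectral_norm_def by (rule onorm_le)

lemma norm_column_le_max_col_norm: "norm (column j A) \<le> max_col_norm A"
  for A :: "real^'n^'m"
  unfolding max_col_norm_def by (rule Max_ge) auto

lemma max_col_norm_nonneg: "0 \<le> max_col_norm A"
  for A :: "real^'n^'m"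
  using norm_column_le_max_col_norm[of undefined A] norm_ge_zero order_trans by blast

lemma max_col_norm_leI: "(\<And>j. norm (column j A) \<le> c) \<Longrightarrow> max_col_norm A \<le> c"
  for A :: "real^'n^'m"
  unfolding max_col_norm_def by (subst Max_le_iff) auto

lemma max_col_norm_le_spectral_norm: "max_col_norm A \<le> spectral_norm A"
  for A :: "real^'n^'m"
  unfolding spectral_norm_def by (intro max_col_norm_leI norm_column_le_onorm)

lemma norm_sq_eq_sum_entries: "(norm A)\<^sup>2 = (\<Sum>i\<in>UNIV. \<Sum>j\<in>UNIV. (A $ i $ j)\<^sup>2)"
  for A :: "real^'n^'m"
  by (simp add: frobenius_norm_eq sum_nonneg)

lemma norm_transpose: "norm (transpose A) = norm A"
  for A :: "real^'n^'m"
proof -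
  have "(norm (transpose A))\<^sup>2 = (norm A)\<^sup>2"
    unfolding norm_sq_eq_sum_entries transpose_def by (simp, rule sum.swap)
  then show ?thesis
    by simp
qed

lemma norm_vec_sq: "(norm x)\<^sup>2 = (\<Sum>i\<in>UNIV. (norm (x $ i))\<^sup>2)"
  for x :: "'a::real_normed_vector^'n"
  by (simp add: norm_vec_def L2_set_def sum_nonneg)

lemma norm_sq_eq_sum_columns: "(norm A)\<^sup>2 = (\<Sum>j\<in>UNIV. (norm (column j A))\<^sup>2)"
  for A :: "real^'n^'m"
proof -
  have "transpose A $ j = column j A" for j
    by (simp add: transpose_def column_def vec_eq_iff)
  then show ?thesis
    using norm_vec_sq[of "transpose A"] by (simp add: norm_transpose)
qed

lemma norm_le_max_col_norm: "norm A \<le> sqrt (CARD('n)) * max_col_norm A"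
  for A :: "real^'n^'m"
proof -
  have "(norm A)\<^sup>2 \<le> (\<Sum>j\<in>(UNIV::'n set). (max_col_norm A)\<^sup>2)"
    unfolding norm_sq_eq_sum_columns
    by (intro sum_mono power_mono norm_column_le_max_col_norm) auto
  also have "\<dots> = (sqrt (CARD('n)) * max_col_norm A)\<^sup>2"
    by (simp add: power_mult_distrib)
  finally show ?thesis
    by (rule power2_le_imp_le) (simp add: max_col_norm_nonneg)
qed

lemma norm_mult_vec_le_norm: "norm (A *v x) \<le> norm A * norm x"
  for A :: "real^'n^'m"
proof -
  have "(norm (A *v x))\<^sup>2 = (\<Sum>i\<in>UNIV. ((A $ i) \<bullet> x)\<^sup>2)"
    by (simp add: norm_vec_sq[of "A *v x"] matrix_vector_mul_component)
  also have "\<dots> \<le> (\<Sum>i\<in>UNIV. (norm (A $ i) * norm x)\<^sup>2)"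
    by (intro sum_mono abs_le_square_iff[THEN iffD1]) (simp add: Cauchy_Schwarz_ineq2)
  also have "\<dots> = (norm A * norm x)\<^sup>2"
    by (simp add: power_mult_distrib norm_vec_sq[of A] sum_distrib_right)
  finally show ?thesis
    by (rule power2_le_imp_le) simp
qed

lemma spectral_norm_le_norm: "spectral_norm A \<le> norm A"
  for A :: "real^'n^'m"
  by (rule spectral_norm_leI) (rule norm_mult_vec_le_norm)

lemma column_mult: "column j (A ** B) = A *v column j B"
  for A :: "real^'n^'m" and B :: "real^'k^'n"
  by (simp add: column_def matrix_matrix_mult_def matrix_vector_mult_def vec_eq_iff)

lemma inner_transpose_mult_vec: "x \<bullet> (transpose A *v y) = (A *v x) \<bullet> y"
  for A :: "real^'n^'m"
  by (metis dot_lmul_matrix inner_commute transpose_matrix_vector)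

text \<open>With \<open>y = transpose A *v x\<close>, the square of \<open>norm y\<close> is the
  inner product of \<open>A *v y\<close> with \<open>x\<close>. Cauchy-Schwarz then leaves one
  factor \<open>norm y\<close> to cancel.\<close>

lemma spectral_norm_transpose_le: "spectral_norm (transpose A) \<le> spectral_norm A"
  for A :: "real^'n^'m"
proof (rule spectral_norm_leI)
  fix x
  let ?y = "transpose A *v x"
  have "norm ?y * norm ?y = (A *v ?y) \<bullet> x"
    by (metis inner_transpose_mult_vec norm_eq_sqrt_inner power2_eq_square real_sqrt_pow2 inner_ge_zero)
  also have "\<dots> \<le> norm (A *v ?y) * norm x"
    by (rule norm_cauchy_schwarz)
  also have "\<dots> \<le> (spectral_norm A * norm ?y) * norm x"
    by (intro mult_right_mono norm_mult_vec_le_spectral_norm) simp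
  finally have "norm ?y * norm ?y \<le> norm ?y * (spectral_norm A * norm x)"
    by (simp add: mult_ac)
  then show "norm ?y \<le> spectral_norm A * norm x"
    by (cases "norm ?y = 0") (simp_all add: spectral_norm_nonneg)
qed

text \<open>The columns of the product are images of the columns of \<open>B\<close>. Mixing the two
  norms in this way avoids the extra factor that two Frobenius norms would cost.\<close>

lemma norm_mult_le_left: "norm (A ** B) \<le> spectral_norm A * norm B"
  for A :: "real^'n^'m" and B :: "real^'k^'n"
proof -
  have "(norm (A ** B))\<^sup>2 \<le> (\<Sum>j\<in>UNIV. (spectral_norm A * norm (column j B))\<^sup>2)"
    unfolding norm_sq_eq_sum_columns column_mult
    by (intro sum_mono power_mono norm_mult_vec_le_spectral_norm) auto
  also have "\<dots> = (spectral_norm A * norm B)\<^sup>2"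
    by (simp add: power_mult_distrib norm_sq_eq_sum_columns[of B] sum_distrib_left)
  finally show ?thesis
    by (rule power2_le_imp_le) (simp add: spectral_norm_nonneg)
qed

lemma norm_mult_le_right: "norm (A ** B) \<le> norm A * spectral_norm B"
  for A :: "real^'n^'m" and B :: "real^'k^'n"
proof -
  have "norm (A ** B) = norm (transpose B ** transpose A)"
    by (metis matrix_transpose_mul norm_transpose)
  also have "\<dots> \<le> spectral_norm (transpose B) * norm (transpose A)"
    by (rule norm_mult_le_left)
  also have "\<dots> \<le> spectral_norm B * norm A"
    by (intro mult_mono) (simp_all add: spectral_norm_transpose_le norm_transpose spectral_norm_nonneg)
  finally show ?thesis
    by (simp add: mult.commute)
qed

section \<open>Entrywise absolute values\<close>

lemma norm_abs_matrix: "norm \<bar>A\<bar> = norm A"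
  for A :: "real^'n^'m"
  by (simp add: frobenius_norm_eq abs_vec_def)

lemma max_col_norm_abs: "max_col_norm \<bar>A\<bar> = max_col_norm A"
  for A :: "real^'n^'m"
proof -
  have "norm (column j \<bar>A\<bar>) = norm (column j A)" for j
    by (simp add: norm_vec_def L2_set_def column_def abs_vec_def)
  then show ?thesis
    by (simp add: max_col_norm_def)
qed

lemma norm_le_of_abs_le: "\<bar>E\<bar> \<le> c *\<^sub>R F \<Longrightarrow> 0 \<le> c \<Longrightarrow> norm E \<le> c * norm F"
  for E F :: "real^'n^'m"
proof -
  assume le: "\<bar>E\<bar> \<le> c *\<^sub>R F" and "0 \<le> c"
  have "\<bar>E $ i $ j\<bar> \<le> \<bar>(c *\<^sub>R F) $ i $ j\<bar>" for i j
  proof -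
    have "\<bar>E\<bar> $ i $ j \<le> (c *\<^sub>R F) $ i $ j"
      using le by (simp add: less_eq_vec_def)
    then show ?thesis
      by (simp add: abs_vec_def)
  qed
  then have "norm E \<le> norm (c *\<^sub>R F)"
    by (intro norm_le_componentwise_cart) simp
  then show ?thesis
    using \<open>0 \<le> c\<close> by simp
qed

text \<open>Passing to absolute values preserves the Frobenius norm and the column norms, but may
  increase the spectral norm. So \<open>\<bar>A\<bar>\<close> is measured in the Frobenius norm,
  which costs \<open>sqrt n\<close>; summing over the columns of the product costs another
  \<open>sqrt n\<close>. Keeping the column norm of \<open>B\<close> is what later produces the
  factor \<open>p\<close>.\<close>

lemma norm_abs_mult_le:
  "norm (\<bar>A\<bar> ** \<bar>B\<bar>) \<le> CARD('n) * (spectral_norm A * max_col_norm B)"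
  for A :: "real^'n^'m" and B :: "real^'n^'n"
proof -
  have "norm (\<bar>A\<bar> ** \<bar>B\<bar>) \<le> sqrt CARD('n) * max_col_norm (\<bar>A\<bar> ** \<bar>B\<bar>)"
    by (rule norm_le_max_col_norm)
  also have "max_col_norm (\<bar>A\<bar> ** \<bar>B\<bar>) \<le> norm A * max_col_norm B"
  proof (rule max_col_norm_leI)
    fix j
    have "norm (column j (\<bar>A\<bar> ** \<bar>B\<bar>)) \<le> norm \<bar>A\<bar> * norm (column j \<bar>B\<bar>)"
      unfolding column_mult by (rule norm_mult_vec_le_norm)
    also have "\<dots> \<le> norm A * max_col_norm B"
      using norm_column_le_max_col_norm[of j "\<bar>B\<bar>"]
      by (intro mult_mono) (simp_all add: norm_abs_matrix max_col_norm_abs)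
    finally show "norm (column j (\<bar>A\<bar> ** \<bar>B\<bar>)) \<le> norm A * max_col_norm B" .
  qed
  also have "norm A \<le> sqrt CARD('n) * spectral_norm A"
    using norm_le_max_col_norm[of A] max_col_norm_le_spectral_norm[of A]
    by (meson mult_left_mono order_trans real_sqrt_ge_zero of_nat_0_le_iff)
  finally show ?thesis
    by (simp add: mult_ac mult_left_mono max_col_norm_nonneg mult_right_mono)
qed

lemma norm_abs_gram_le: "norm (transpose \<bar>A\<bar> ** \<bar>A\<bar>) \<le> CARD('n) * (max_col_norm A)\<^sup>2"
  for A :: "real^'n^'m"
proof -
  have "norm (transpose \<bar>A\<bar> ** \<bar>A\<bar>) \<le> spectral_norm (transpose \<bar>A\<bar>) * norm \<bar>A\<bar>"
    by (rule norm_mult_le_left)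
  also have "\<dots> \<le> norm A * norm A"
    using spectral_norm_le_norm[of "transpose \<bar>A\<bar>"]
    by (intro mult_mono) (simp_all add: norm_transpose norm_abs_matrix)
  also have "\<dots> \<le> (sqrt CARD('n) * max_col_norm A) * (sqrt CARD('n) * max_col_norm A)"
    by (intro mult_mono norm_le_max_col_norm) (simp_all add: max_col_norm_nonneg)
  finally show ?thesis
    by (simp add: power2_eq_square mult_ac)
qed

section \<open>Gram matrices and their quadratic forms\<close>

lemma gram_diag: "(transpose A ** A) $ j $ j = (norm (column j A))\<^sup>2"
  for A :: "real^'n^'m"
  by (simp add: matrix_mult_transpose_dot_column power2_norm_eq_inner)

lemma abs_gram_diag: "(transpose \<bar>A\<bar> ** \<bar>A\<bar>) $ j $ j = (norm (column j A))\<^sup>2"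
  for A :: "real^'n^'m"
  by (simp add: gram_diag norm_vec_def L2_set_def column_def abs_vec_def)

lemma norm_mult_vec_sq: "(norm (A *v z))\<^sup>2 = z \<bullet> ((transpose A ** A) *v z)"
  for A :: "real^'n^'m"
  by (metis inner_transpose_mult_vec matrix_vector_mul_assoc power2_norm_eq_inner)

text \<open>This takes the place of eigenvalue perturbation theory: comparing
  \<open>norm (R *v z)\<close> with \<open>norm (A *v z)\<close> for each \<open>z\<close> carries
  gain bounds from \<open>A\<close> to \<open>R\<close> and back.\<close>

lemma shifted_gram_quadratic_form:
  fixes R :: "real^'n^'k" and A :: "real^'n^'m"
  assumes "transpose R ** R = transpose A ** A + s *\<^sub>R mat 1 + E"
  shows "\<bar>(norm (R *v z))\<^sup>2 - ((norm (A *v z))\<^sup>2 + s * (norm z)\<^sup>2)\<bar> \<le> norm E * (norm z)\<^sup>2"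
proof -
  have "(s *\<^sub>R mat 1) *v z = s *\<^sub>R z"
    by (simp flip: scaleR_matrix_vector_assoc)
  then have "(norm (R *v z))\<^sup>2 = (norm (A *v z))\<^sup>2 + s * (norm z)\<^sup>2 + z \<bullet> (E *v z)"
    unfolding norm_mult_vec_sq assms
    by (simp add: matrix_vector_mult_add_rdistrib inner_add_right power2_norm_eq_inner)
  moreover have "\<bar>z \<bullet> (E *v z)\<bar> \<le> norm E * (norm z)\<^sup>2"
    using Cauchy_Schwarz_ineq2[of z "E *v z"]
      mult_left_mono[OF norm_mult_vec_le_norm[of E z] norm_ge_zero[of z]]
    by (simp add: power2_eq_square mult_ac)
  ultimately show ?thesis
    by simp
qed

lemma matrix_inv_left: "invertible A \<Longrightarrow> matrix_inv A ** A = mat 1"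
  for A :: "real^'n^'m"
  unfolding invertible_def matrix_inv_def by (rule someI2_ex) auto

text \<open>Each row satisfies \<open>q_i (R + E_i) = x_i\<close> with its own perturbation. The
  vectors \<open>q_i E_i\<close> are collected as the rows of one matrix \<open>W\<close>, so that
  the solve becomes a single matrix equation with an entrywise bound of the same shape as that of a
  multiplication.\<close>

lemma fl_right_solve_residual:
  fixes A Q :: "real^'n^'m"
  assumes "fl_right_solve A R Q"
  obtains W where "Q ** R = A - W" "\<bar>W\<bar> \<le> fl_gamma CARD('n) *\<^sub>R (\<bar>Q\<bar> ** \<bar>R\<bar>)"
proof -
  obtain E where E: "\<And>i. \<bar>E i\<bar> \<le> fl_gamma CARD('n) *\<^sub>R \<bar>R\<bar>"
      "\<And>i. invertible (R + E i)" "\<And>i. row i Q = row i A v* matrix_inv (R + E i)"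
    using assms unfolding fl_right_solve_def by metis
  define W where "W = (\<chi> i. row i Q v* E i)"
  have row: "row i Q v* R = row i A - W $ i" for i
  proof -
    have "row i Q v* (R + E i) = row i A"
      unfolding E(3) vector_matrix_mul_assoc
      using E(2)[of i] by (simp add: matrix_inv_left)
    then show ?thesis
      by (simp add: W_def vector_matrix_mult_add_rdistrib algebra_simps)
  qed
  have "Q ** R = A - W"
  proof -
    have "(Q ** R) $ i = (A - W) $ i" for i
      using row[of i]
      by (simp add: vec_eq_iff row_def matrix_matrix_mult_def vector_matrix_mult_def mult.commute)
    then show ?thesis
      by (simp add: vec_eq_iff)
  qed
  moreover have "\<bar>W\<bar> \<le> fl_gamma CARD('n) *\<^sub>R (\<bar>Q\<bar> ** \<bar>R\<bar>)"
  proof -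
    have "\<bar>W $ i $ j\<bar> \<le> fl_gamma CARD('n) * (\<Sum>k\<in>UNIV. \<bar>Q $ i $ k\<bar> * \<bar>R $ k $ j\<bar>)" for i j
    proof -
      have "\<bar>W $ i $ j\<bar> \<le> (\<Sum>k\<in>UNIV. \<bar>Q $ i $ k * E i $ k $ j\<bar>)"
        unfolding W_def vector_matrix_mult_def row_def by (simp add: sum_abs)
      also have "\<dots> \<le> (\<Sum>k\<in>UNIV. fl_gamma CARD('n) * (\<bar>Q $ i $ k\<bar> * \<bar>R $ k $ j\<bar>))"
      proof (rule sum_mono)
        fix k
        have "\<bar>E i $ k $ j\<bar> \<le> fl_gamma CARD('n) * \<bar>R $ k $ j\<bar>"
          using E(1)[of i] by (simp add: less_eq_vec_def abs_vec_def)
        then show "\<bar>Q $ i $ k * E i $ k $ j\<bar> \<le> fl_gamma CARD('n) * (\<bar>Q $ i $ k\<bar> * \<bar>R $ k $ j\<bar>)"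
          using mult_left_mono[of _ _ "\<bar>Q $ i $ k\<bar>"] by (fastforce simp: abs_mult mult_ac)
      qed
      finally show ?thesis
        by (simp add: sum_distrib_left)
    qed
    then show ?thesis
      by (simp add: less_eq_vec_def abs_vec_def matrix_matrix_mult_def)
  qed
  ultimately show thesis
    using that by blast
qed

subsection \<open>Singular values\<close>

text \<open>If \<open>w = S *v v\<close> were nonzero, the form at \<open>v - t w\<close> would
  equal \<open>t (t b - 2 a)\<close> with \<open>a > 0\<close>, which is negative for small positive
  \<open>t\<close>.\<close>

lemma psd_quadratic_form_zero:
  fixes S :: "real^'n^'n"
  assumes sym: "transpose S = S" and psd: "\<And>z. 0 \<le> z \<bullet> (S *v z)" and zero: "v \<bullet> (S *v v) = 0"
  shows "S *v v = 0"
proof (rule ccontr)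
  assume "S *v v \<noteq> 0"
  define w where "w = S *v v"
  define a where "a = w \<bullet> w"
  define b where "b = w \<bullet> (S *v w)"
  have "a > 0"
    using \<open>S *v v \<noteq> 0\<close> by (simp add: a_def w_def)
  have "b \<ge> 0"
    using psd by (simp add: b_def)
  have vSw: "v \<bullet> (S *v w) = a"
    using inner_transpose_mult_vec[of v S w] by (simp only: sym w_def a_def)
  have nonneg: "0 \<le> t * (t * b - 2 * a)" for t
  proof -
    have "0 \<le> (v - t *\<^sub>R w) \<bullet> (S *v (v - t *\<^sub>R w))"
      by (rule psd)
    also have "\<dots> = t * (t * b - 2 * a)"
      using zero vSw
      by (simp add: matrix_vector_mult_diff_distrib matrix_vector_mult_scaleR inner_diff_left
          inner_diff_right a_def b_def flip: w_def) (simp add: algebra_simps)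
    finally show ?thesis .
  qed
  \<comment> \<open>This choice gives \<open>t b \<le> a < 2 a\<close>; the added 1 keeps the
    denominator positive when \<open>b = 0\<close>.\<close>
  define t where "t = a / (b + 1)"
  have "0 < t"
    using \<open>a > 0\<close> \<open>b \<ge> 0\<close> by (simp add: t_def)
  then have "0 \<le> t * b - 2 * a"
    using nonneg[of t] by (simp add: zero_le_mult_iff)
  moreover have "t * b \<le> a"
    using \<open>a > 0\<close> \<open>b \<ge> 0\<close> by (simp add: t_def field_simps)
  ultimately show False
    using \<open>a > 0\<close> by simp
qed

lemma transpose_gram: "transpose (transpose A ** A) = transpose A ** A"
  for A :: "real^'n^'m"
  by (simp add: matrix_transpose_mul)

lemma transpose_diff: "transpose (A - B) = transpose A - transpose B"
  for A B :: "real^'n^'m"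
  by (simp add: transpose_def vec_eq_iff)

text \<open>Eigenvectors of the symmetric Gram matrix for distinct eigenvalues are orthogonal, and a
  pairwise orthogonal set is finite. Finiteness is what gives \<open>Max\<close> and
  \<open>Min\<close> in \<open>cond2\<close> their meaning.\<close>

lemma finite_singular_values: "finite (singular_values A)"
  for A :: "real^'n^'m"
proof -
  let ?G = "transpose A ** A"
  obtain f where f: "\<And>\<sigma>. \<sigma> \<in> singular_values A \<Longrightarrow> f \<sigma> \<noteq> 0 \<and> ?G *v f \<sigma> = \<sigma>\<^sup>2 *\<^sub>R f \<sigma>"
    using bchoice[of "singular_values A" "\<lambda>\<sigma> v. v \<noteq> 0 \<and> ?G *v v = \<sigma>\<^sup>2 *\<^sub>R v"]
    by (auto simp: singular_values_def)
  have ortho: "f \<sigma> \<bullet> f \<tau> = 0"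
    if "\<sigma> \<in> singular_values A" "\<tau> \<in> singular_values A" "\<sigma> \<noteq> \<tau>" for \<sigma> \<tau>
  proof -
    have "\<sigma>\<^sup>2 * (f \<sigma> \<bullet> f \<tau>) = \<tau>\<^sup>2 * (f \<sigma> \<bullet> f \<tau>)"
      using inner_transpose_mult_vec[of "f \<sigma>" ?G "f \<tau>"] f[OF that(1)] f[OF that(2)]
      by (simp only: transpose_gram inner_scaleR_left inner_scaleR_right)
    moreover have "\<sigma>\<^sup>2 \<noteq> \<tau>\<^sup>2"
      using that by (auto simp: singular_values_def power2_eq_iff_nonneg)
    ultimately show ?thesis
      by simp
  qed
  have "inj_on f (singular_values A)"
    using ortho f by (metis inj_onI inner_eq_zero_iff)
  moreover have "finite (f ` singular_values A)"
    by (rule pairwise_orthogonal_imp_finite) (auto simp: pairwise_def orthogonal_def intro!: ortho)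
  ultimately show ?thesis
    by (rule finite_imageD[rotated])
qed

text \<open>The sign \<open>c\<close> treats a largest gain (\<open>c = 1\<close>) and a smallest
  gain (\<open>c = -1\<close>) together. In both cases \<open>c (\<sigma>^2 I - A^T A)\<close> is
  positive semidefinite and its form vanishes at \<open>v\<close>, so \<open>v\<close> lies in its
  kernel.\<close>

lemma extremal_gain_singular_value:
  fixes A :: "real^'n^'m"
  assumes "norm v = 1" and "c = 1 \<or> c = -1"
    and extremal: "\<And>z. c * (norm (A *v z))\<^sup>2 \<le> c * (norm (A *v v) * norm z)\<^sup>2"
  shows "norm (A *v v) \<in> singular_values A"
proof -
  let ?\<sigma> = "norm (A *v v)"
  define S where "S = c *\<^sub>R (?\<sigma>\<^sup>2 *\<^sub>R mat 1 - transpose A ** A)"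
  have S: "S *v z = c *\<^sub>R (?\<sigma>\<^sup>2 *\<^sub>R z - (transpose A ** A) *v z)" for z
    by (simp add: S_def matrix_vector_mult_diff_rdistrib del: transpose_matrix_vector
        flip: scaleR_matrix_vector_assoc)
  have quad: "z \<bullet> (S *v z) = c * ((?\<sigma> * norm z)\<^sup>2 - (norm (A *v z))\<^sup>2)" for z
    unfolding S by (simp add: norm_mult_vec_sq[of A z] inner_diff_right power_mult_distrib
        power2_norm_eq_inner[of z])
  have "S *v v = 0"
  proof (rule psd_quadratic_form_zero)
    show "transpose S = S"
      by (simp add: S_def transpose_scalar transpose_diff transpose_gram)
    show "0 \<le> z \<bullet> (S *v z)" for z
      using extremal[of z] by (simp add: quad algebra_simps)
    show "v \<bullet> (S *v v) = 0"
      using assms(1) by (simp add: quad)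
  qed
  then have "(transpose A ** A) *v v = ?\<sigma>\<^sup>2 *\<^sub>R v"
    using assms(2) unfolding S by auto
  moreover have "v \<noteq> 0"
    using assms(1) by auto
  ultimately show ?thesis
    by (auto simp: singular_values_def)
qed

lemma mult_vec_unit:
  fixes A :: "real^'n^'m"
  assumes "z \<noteq> 0"
  shows "norm (A *v z) = norm (A *v (z /\<^sub>R norm z)) * norm z"
  using assms by (simp add: matrix_vector_mult_scaleR)

text \<open>The gain is continuous on the compact unit sphere and therefore attains its bounds;
  homogeneity extends them to all vectors.\<close>

lemma extreme_gains:
  fixes A :: "real^'n^'m"
  obtains v w where "norm v = 1" "norm w = 1"
    "\<And>z. norm (A *v z) \<le> norm (A *v v) * norm z" "\<And>z. norm (A *v w) * norm z \<le> norm (A *v z)"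
proof -
  let ?S = "sphere (0 :: real^'n) 1"
  have "axis undefined 1 \<in> ?S"
    by simp
  then have ne: "?S \<noteq> {}"
    by blast
  have cont: "continuous_on ?S (\<lambda>z. norm (A *v z))"
    by (intro continuous_on_norm linear_continuous_on) simp
  obtain v where v: "v \<in> ?S" "\<And>z. z \<in> ?S \<Longrightarrow> norm (A *v z) \<le> norm (A *v v)"
    using continuous_attains_sup[OF _ ne cont] by auto
  obtain w where w: "w \<in> ?S" "\<And>z. z \<in> ?S \<Longrightarrow> norm (A *v w) \<le> norm (A *v z)"
    using continuous_attains_inf[OF _ ne cont] by auto
  have unit: "z /\<^sub>R norm z \<in> ?S" if "z \<noteq> 0" for z
    using that by simp
  show thesis
  proof
    show "norm v = 1" "norm w = 1"
      using v w by simp_all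
    show "norm (A *v z) \<le> norm (A *v v) * norm z" for z
      using v(2)[OF unit, of z] mult_vec_unit[of z A]
      by (cases "z = 0") (auto intro!: mult_right_mono)
    show "norm (A *v w) * norm z \<le> norm (A *v z)" for z
      using w(2)[OF unit, of z] mult_vec_unit[of z A]
      by (cases "z = 0") (auto intro!: mult_right_mono)
  qed
qed

text \<open>Both extreme gains are singular values. Hence \<open>Max\<close> is at least the
  spectral norm and \<open>Min\<close> at most the smallest gain, which are the directions that this
  inequality requires. Full rank makes \<open>Min\<close> positive.\<close>

lemma spectral_norm_le_cond2_mult:
  fixes A :: "real^'n^'m"
  assumes "rank A = CARD('n)"
  shows "spectral_norm A * norm z \<le> cond2 A * norm (A *v z)"
proof -
  obtain v w where v1: "norm v = 1" and w1: "norm w = 1"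
    and v: "\<And>z. norm (A *v z) \<le> norm (A *v v) * norm z"
    and w: "\<And>z. norm (A *v w) * norm z \<le> norm (A *v z)"
    by (rule extreme_gains[of A]) (rule that)
  have inj: "A *v z \<noteq> 0" if "z \<noteq> 0" for z
    using assms that by (metis matrix_nonfull_linear_equations_eq)
  have sv: "norm (A *v v) \<in> singular_values A" "norm (A *v w) \<in> singular_values A"
    using extremal_gain_singular_value[OF v1, of 1] v
      extremal_gain_singular_value[OF w1, of "-1"] w
    by (auto intro!: power_mono)
  have "spectral_norm A \<le> norm (A *v v)"
    by (rule spectral_norm_leI) (rule v)
  also have "\<dots> \<le> Max (singular_values A)"
    using finite_singular_values sv(1) by (rule Max_ge)
  finally have max: "spectral_norm A \<le> Max (singular_values A)" .
  \<comment> \<open>A singular value 0 would yield a nonzero vector annihilated by \<open>A\<close>,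
    against full rank.\<close>
  have pos: "\<sigma> > 0" if "\<sigma> \<in> singular_values A" for \<sigma>
  proof -
    have "0 \<le> \<sigma>" and ev: "\<exists>x. x \<noteq> 0 \<and> (transpose A ** A) *v x = \<sigma>\<^sup>2 *\<^sub>R x"
      using that by (simp_all only: singular_values_def mem_Collect_eq)
    obtain x where "x \<noteq> 0" and x: "(transpose A ** A) *v x = \<sigma>\<^sup>2 *\<^sub>R x"
      using ev by (elim exE conjE)
    have "(norm (A *v x))\<^sup>2 = \<sigma>\<^sup>2 * (norm x)\<^sup>2"
      by (simp only: norm_mult_vec_sq x inner_scaleR_right power2_norm_eq_inner[of x])
    then show ?thesis
      using inj[OF \<open>x \<noteq> 0\<close>] \<open>0 \<le> \<sigma>\<close> by (cases "\<sigma> = 0") auto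
  qed
  define \<mu> where "\<mu> = Min (singular_values A)"
  have "\<mu> \<in> singular_values A"
    unfolding \<mu>_def using finite_singular_values sv by (intro Min_in) auto
  then have "\<mu> > 0"
    by (rule pos)
  have "\<mu> \<le> norm (A *v w)"
    unfolding \<mu>_def using finite_singular_values sv(2) by (rule Min_le)
  then have "\<mu> * norm z \<le> norm (A *v z)"
    using w[of z] by (meson mult_right_mono norm_ge_zero order_trans)
  then have "Max (singular_values A) * (\<mu> * norm z) \<le> Max (singular_values A) * norm (A *v z)"
    using max spectral_norm_nonneg[of A] by (intro mult_left_mono) auto
  then have "Max (singular_values A) * norm z \<le> cond2 A * norm (A *v z)"
    using \<open>\<mu> > 0\<close> by (simp add: cond2_def flip: \<mu>_def) (simp add: field_simps)
  then show ?thesis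
    using mult_right_mono[OF max norm_ge_zero[of z]] by linarith
qed

subsection \<open>Backward errors\<close>

text \<open>For \<open>k u \<le> 1/1100\<close> the factor \<open>1 / (1 - k u)\<close> is at most
  \<open>1100/1099\<close>, which is below 1.001. The threshold is the one that the smallness of the
  shift gives for \<epsilon>.\<close>

lemma fl_gamma_bounds:
  assumes "real k * unit_roundoff \<le> 1 / 1100"
  shows "0 \<le> fl_gamma k" "fl_gamma k \<le> 1001 / 1000 * (real k * unit_roundoff)"
proof -
  define x where "x = real k * unit_roundoff"
  have x: "0 \<le> x" "x \<le> 1 / 1100"
    using assms by (simp_all add: x_def unit_roundoff_def)
  then show "0 \<le> fl_gamma k"
    by (simp add: fl_gamma_def flip: x_def)
  have "x \<le> 1001 / 1000 * x * (1 - x)"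
  proof -
    have "1100 * (x * x) \<le> x" "0 \<le> x * x"
      using x mult_left_mono[of "1100 * x" 1 x] by simp_all
    moreover have "1001 / 1000 * x * (1 - x) = 1001 / 1000 * x - (1001 / 1000) * (x * x)"
      by (simp add: right_diff_distrib)
    ultimately show ?thesis
      by linarith
  qed
  then show "fl_gamma k \<le> 1001 / 1000 * (real k * unit_roundoff)"
    using x unfolding fl_gamma_def x_def[symmetric] by (simp add: divide_le_eq)
qed

lemma one_le_CARD: "1 \<le> real CARD('n::finite)"
  using zero_less_card_finite[where 'a='n] by linarith

lemma unit_roundoff_pos: "0 < unit_roundoff"
  by (simp add: unit_roundoff_def)

text \<open>The errors of forming the Gram matrix and of factoring it are merged into one matrix. As
  the second is bounded in terms of \<open>R\<close> itself, the column norms of \<open>R\<close>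
  are estimated first. The case \<open>s = 0\<close> serves the two unshifted steps.\<close>

lemma fl_gram_cholesky_error:
  fixes A :: "real^('n::{finite,linorder})^'m"
    and R B :: "real^('n::{finite,linorder})^('n::{finite,linorder})"
  assumes eps: "real CARD('m) * real CARD('n) * unit_roundoff
                + real CARD('n) * (real CARD('n) + 1) * unit_roundoff \<le> \<epsilon>" "\<epsilon> \<le> 1 / 1100"
    and gram: "fl_gram A B" and chol: "fl_cholesky (B + s *\<^sub>R mat 1) R"
    and s: "s \<le> (max_col_norm A)\<^sup>2 / 100"
  obtains E where "transpose R ** R = transpose A ** A + s *\<^sub>R mat 1 + E"
    "norm E \<le> 10151 / 10000 * \<epsilon> * (max_col_norm A)\<^sup>2" "max_col_norm R \<le> 1007 / 1000 * max_col_norm A"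
proof -
  let ?u = unit_roundoff
  define m n c r where "m = real CARD('m)" and "n = real CARD('n)" and "c = max_col_norm A"
    and "r = max_col_norm R"
  define \<gamma> \<delta> where "\<gamma> = fl_gamma CARD('m)" and "\<delta> = fl_gamma (CARD('n) + 1)"
  have mn: "m \<ge> 1" "n \<ge> 1"
    by (simp_all add: m_def n_def one_le_CARD)
  have eps': "m * n * ?u + n * (n + 1) * ?u \<le> \<epsilon>"
    using eps by (simp add: m_def n_def)
  have mu: "m * ?u \<le> m * n * ?u"
    using mn unit_roundoff_pos mult_left_mono[of 1 n "m * ?u"] by (simp add: mult_ac)
  have nu: "(n + 1) * ?u \<le> n * (n + 1) * ?u"
    using mn unit_roundoff_pos mult_right_mono[of 1 n "(n + 1) * ?u"] by (simp add: mult_ac)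
  have nn0: "0 \<le> n * (n + 1) * ?u" and mn0: "0 \<le> m * n * ?u"
    using mn unit_roundoff_pos by simp_all
  \<comment> \<open>Each quantity is dominated by one of the two nonnegative summands of
    \<epsilon>.\<close>
  have mu': "m * ?u \<le> 1 / 1100" and nu': "(n + 1) * ?u \<le> 1 / 1100"
    using mu nu nn0 mn0 eps' eps(2) by linarith+
  have \<gamma>: "0 \<le> \<gamma>" "\<gamma> \<le> 1001 / 1000 * (m * ?u)"
    using fl_gamma_bounds[of "CARD('m)"] mu' by (simp_all add: m_def \<gamma>_def)
  have \<delta>: "0 \<le> \<delta>" "\<delta> \<le> 1001 / 1000 * ((n + 1) * ?u)"
    using fl_gamma_bounds[of "CARD('n) + 1"] nu' by (simp_all add: n_def \<delta>_def add_ac)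
  have small: "\<gamma> \<le> 1 / 1000" "\<delta> \<le> 1 / 1000"
    using \<gamma> \<delta> mu nu mn0 nn0 eps' eps(2) by linarith+
  obtain E1 where E1: "B = transpose A ** A + E1" "\<bar>E1\<bar> \<le> \<gamma> *\<^sub>R (transpose \<bar>A\<bar> ** \<bar>A\<bar>)"
    using gram by (auto simp: fl_gram_def \<gamma>_def)
  obtain E2 where E2: "transpose R ** R = B + s *\<^sub>R mat 1 + E2"
      "\<bar>E2\<bar> \<le> \<delta> *\<^sub>R (transpose \<bar>R\<bar> ** \<bar>R\<bar>)"
    using chol by (auto simp: fl_cholesky_def \<delta>_def)
  have cr0: "0 \<le> c" "0 \<le> r"
    by (simp_all add: c_def r_def max_col_norm_nonneg)
  \<comment> \<open>The diagonal entries of \<open>R^T R\<close> are the squared column norms.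
    Moving the self-referential error to the left gives
    \<open>0.999 x \<le> (1 + 0.001 + 0.01) c^2\<close>, and \<open>1.011 / 0.999\<close> is below
    \<open>1.007^2 = 1.014049\<close>.\<close>
  have "r \<le> 1007 / 1000 * c"
    unfolding r_def
  proof (rule max_col_norm_leI)
    fix j
    let ?x = "(norm (column j R))\<^sup>2" and ?y = "(norm (column j A))\<^sup>2"
    have "\<bar>E1 $ j $ j\<bar> \<le> \<gamma> * ?y" "\<bar>E2 $ j $ j\<bar> \<le> \<delta> * ?x"
      using E1(2) E2(2) by (simp_all add: less_eq_vec_def abs_vec_def flip: abs_gram_diag)
    moreover have "?x = ?y + E1 $ j $ j + s + E2 $ j $ j"
      using E1(1) E2(1) by (simp add: mat_def flip: gram_diag)
    moreover have "\<gamma> * ?y \<le> 1 / 1000 * ?y" "\<delta> * ?x \<le> 1 / 1000 * ?x"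
      by (rule mult_right_mono[OF small(1) zero_le_power2], rule mult_right_mono[OF small(2) zero_le_power2])
    moreover have "?y \<le> c\<^sup>2"
      unfolding c_def by (intro power_mono norm_column_le_max_col_norm) simp
    ultimately have "999 / 1000 * ?x \<le> 1011 / 1000 * c\<^sup>2"
      using s unfolding c_def by linarith
    then have "?x \<le> 1014049 / 1000000 * c\<^sup>2"
      using zero_le_power2[of c] by linarith
    also have "\<dots> = (1007 / 1000 * c)\<^sup>2"
      by (simp add: power2_eq_square)
    finally have "?x \<le> (1007 / 1000 * c)\<^sup>2" .
    then show "norm (column j R) \<le> 1007 / 1000 * c"
      by (rule power2_le_imp_le) (use cr0 in simp)
  qed
  have "norm E1 \<le> \<gamma> * (n * c\<^sup>2)"
    using norm_le_of_abs_le[OF E1(2) \<gamma>(1)] mult_left_mono[OF norm_abs_gram_le[of A] \<gamma>(1)]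
    by (simp add: n_def c_def)
  also have "\<dots> \<le> (1001 / 1000 * (m * ?u)) * (n * c\<^sup>2)"
    using \<gamma> mn by (intro mult_right_mono) auto
  finally have e1: "norm E1 \<le> 1001 / 1000 * (m * n * ?u) * c\<^sup>2"
    by (simp add: mult_ac)
  have "norm E2 \<le> \<delta> * (n * r\<^sup>2)"
    using norm_le_of_abs_le[OF E2(2) \<delta>(1)] mult_left_mono[OF norm_abs_gram_le[of R] \<delta>(1)]
    by (simp add: n_def r_def)
  also have "\<dots> \<le> (1001 / 1000 * ((n + 1) * ?u)) * (n * (1007 / 1000 * c)\<^sup>2)"
    using \<delta> mn cr0 \<open>r \<le> 1007 / 1000 * c\<close> unit_roundoff_pos
    by (intro mult_mono power_mono mult_left_mono) auto
  also have "\<dots> = (1001 / 1000 * (1007 / 1000)\<^sup>2) * (n * (n + 1) * ?u * c\<^sup>2)"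
    unfolding power_mult_distrib by (simp only: mult_ac)
  \<comment> \<open>The constant rounds up \<open>1.001 * 1.007^2\<close>. The bound on
    \<open>E1\<close> is weakened to the same constant below, so that the two summands of \<epsilon>
    can be added.\<close>
  also have "\<dots> \<le> 10151 / 10000 * (n * (n + 1) * ?u * c\<^sup>2)"
    using nn0 by (intro mult_right_mono) (auto simp: power2_eq_square)
  finally have e2: "norm E2 \<le> 10151 / 10000 * (n * (n + 1) * ?u * c\<^sup>2)" .
  show thesis
  proof
    show "transpose R ** R = transpose A ** A + s *\<^sub>R mat 1 + (E1 + E2)"
      using E1 E2 by (simp add: algebra_simps)
    show "max_col_norm R \<le> 1007 / 1000 * max_col_norm A"
      using \<open>r \<le> 1007 / 1000 * c\<close> by (simp add: r_def c_def)
    have "norm (E1 + E2) \<le> 10151 / 10000 * (m * n * ?u * c\<^sup>2) + (10151 / 10000) * (n * (n + 1) * ?u * c\<^sup>2)"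
      using norm_triangle_ineq[of E1 E2] e1 e2 mult_nonneg_nonneg[OF mn0 zero_le_power2[of c]]
      by linarith
    also have "\<dots> = 10151 / 10000 * (m * n * ?u + n * (n + 1) * ?u) * c\<^sup>2"
      by (simp add: algebra_simps)
    also have "\<dots> \<le> 10151 / 10000 * \<epsilon> * c\<^sup>2"
      using eps' by (intro mult_right_mono mult_left_mono) auto
    finally show "norm (E1 + E2) \<le> 10151 / 10000 * \<epsilon> * (max_col_norm A)\<^sup>2"
      by (simp add: c_def)
  qed
qed

text \<open>One factor \<open>n\<close> comes from \<open>fl_gamma\<close> and one from
  \<open>norm_abs_mult_le\<close>. The bound covers both products and the residuals of solves, where
  the factors are \<open>Q\<close> and \<open>R\<close>.\<close>

lemma fl_mult_norm_error_le:
  fixes A :: "real^'n^'m" and B :: "real^'n^'n"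
  assumes "real CARD('n) * unit_roundoff \<le> 1 / 1100"
    and "\<bar>E\<bar> \<le> fl_gamma CARD('n) *\<^sub>R (\<bar>A\<bar> ** \<bar>B\<bar>)"
  shows "norm E \<le> 1001 / 1000 * ((real CARD('n))\<^sup>2 * unit_roundoff) * (spectral_norm A * max_col_norm B)"
proof -
  let ?ab = "spectral_norm A * max_col_norm B"
  note \<gamma> = fl_gamma_bounds[OF assms(1)]
  have "0 \<le> ?ab"
    by (simp add: spectral_norm_nonneg max_col_norm_nonneg)
  have "norm E \<le> fl_gamma CARD('n) * norm (\<bar>A\<bar> ** \<bar>B\<bar>)"
    by (rule norm_le_of_abs_le[OF assms(2) \<gamma>(1)])
  also have "\<dots> \<le> (1001 / 1000 * (real CARD('n) * unit_roundoff)) * (real CARD('n) * ?ab)"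
    using \<gamma> \<open>0 \<le> ?ab\<close> norm_abs_mult_le[of A B] unit_roundoff_pos by (intro mult_mono) auto
  finally show ?thesis
    by (simp add: power2_eq_square mult_ac)
qed

subsection \<open>One CholeskyQR step\<close>

lemma inverse_of_gain_bound:
  fixes R :: "real^'n^'n"
  assumes "0 < \<rho>" and gain: "\<And>z. \<rho> * norm z \<le> norm (R *v z)"
  obtains P where "R ** P = mat 1" "P ** R = mat 1" "spectral_norm P \<le> 1 / \<rho>"
proof -
  have "z = 0" if "R *v z = 0" for z
    using gain[of z] that \<open>0 < \<rho>\<close> by (simp add: mult_le_0_iff)
  then obtain P where P: "P ** R = mat 1"
    using matrix_left_invertible_ker[of R] by auto
  then have P': "R ** P = mat 1"
    using matrix_left_right_inverse by blast
  have "spectral_norm P \<le> 1 / \<rho>"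
  proof (rule spectral_norm_leI)
    fix y
    have "R *v (P *v y) = y"
      by (simp add: matrix_vector_mul_assoc P')
    then show "norm (P *v y) \<le> 1 / \<rho> * norm y"
      using gain[of "P *v y"] \<open>0 < \<rho>\<close> by (simp add: field_simps)
  qed
  then show thesis
    using P P' that by blast
qed

lemma norm_mult_right_ge:
  fixes R :: "real^'n^'n" and S :: "real^'n^'m"
  assumes "0 < \<rho>" and gain: "\<And>z. \<rho> * norm z \<le> norm (R *v z)"
  shows "\<rho> * norm S \<le> norm (S ** R)"
proof -
  obtain P where P: "R ** P = mat 1" "spectral_norm P \<le> 1 / \<rho>"
    using inverse_of_gain_bound[OF assms] by blast
  have "norm S = norm ((S ** R) ** P)"
    by (simp add: P(1) flip: matrix_mul_assoc)
  also have "\<dots> \<le> norm (S ** R) * spectral_norm P"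
    by (rule norm_mult_le_right)
  also have "\<dots> \<le> norm (S ** R) * (1 / \<rho>)"
    using P(2) by (rule mult_left_mono) simp
  finally show ?thesis
    using \<open>0 < \<rho>\<close> by (simp add: field_simps)
qed

text \<open>The right factor is removed twice, the second time after a transposition. This strips
  \<open>R\<close> from \<open>R^T (Q^T Q - I) R\<close>.\<close>

lemma norm_congruence_ge:
  fixes R S :: "real^'n^'n"
  assumes "0 < \<rho>" and gain: "\<And>z. \<rho> * norm z \<le> norm (R *v z)"
  shows "\<rho>\<^sup>2 * norm S \<le> norm (transpose R ** S ** R)"
proof -
  have "\<rho>\<^sup>2 * norm S = \<rho> * (\<rho> * norm (transpose S))"
    by (simp add: power2_eq_square norm_transpose)
  also have "\<dots> \<le> \<rho> * norm (transpose S ** R)"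
    using norm_mult_right_ge[OF assms] \<open>0 < \<rho>\<close> by (intro mult_left_mono) auto
  also have "\<dots> = \<rho> * norm (transpose R ** S)"
    by (metis matrix_transpose_mul norm_transpose transpose_transpose)
  also have "\<dots> \<le> norm (transpose R ** S ** R)"
    by (rule norm_mult_right_ge[OF assms])
  finally show ?thesis .
qed

text \<open>For \<open>y = R z\<close> one has \<open>Q y = A z - W z\<close>, and
  \<open>\<rho> * norm z \<le> norm y\<close> turns the bound on \<open>W\<close> into a relative
  error \<theta> times the norm of \<open>Q\<close>.\<close>

lemma right_solve_bounds:
  fixes A Q W :: "real^'n^'m" and R :: "real^'n^'n"
  assumes "0 < \<rho>" and gain: "\<And>z. \<rho> * norm z \<le> norm (R *v z)"
    and QR: "Q ** R = A - W" and W: "norm W \<le> \<theta> * \<rho> * spectral_norm Q" and "\<theta> < 1"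
    and upper: "\<And>z. norm (A *v z) \<le> \<alpha> * norm (R *v z)"
    and lower: "\<And>z. \<beta> * norm (R *v z) \<le> norm (A *v z)"
  shows "spectral_norm Q \<le> \<alpha> / (1 - \<theta>)"
    and "(\<beta> - \<theta> * spectral_norm Q) * norm y \<le> norm (Q *v y)"
proof -
  let ?q = "spectral_norm Q"
  obtain P where P: "R ** P = mat 1" "spectral_norm P \<le> 1 / \<rho>"
    using inverse_of_gain_bound[OF assms(1,2)] by blast
  have both: "norm (Q *v y) \<le> (\<alpha> + \<theta> * ?q) * norm y"
    "(\<beta> - \<theta> * ?q) * norm y \<le> norm (Q *v y)" for y
  proof -
    define z where "z = P *v y"
    have Rz: "R *v z = y"
      by (simp add: z_def matrix_vector_mul_assoc P(1))
    have Qy: "Q *v y = A *v z - W *v z"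
      by (metis QR Rz matrix_vector_mul_assoc matrix_vector_mult_diff_rdistrib)
    have Wz: "norm (W *v z) \<le> \<theta> * ?q * norm y"
    proof -
      have "norm (W *v z) \<le> (\<theta> * \<rho> * ?q) * norm z"
        using norm_mult_vec_le_norm[of W z] mult_right_mono[OF W norm_ge_zero[of z]] by linarith
      moreover have "0 \<le> \<theta> * \<rho> * ?q"
        using W norm_ge_zero order_trans by blast
      then have "0 \<le> \<theta> * ?q"
        using \<open>0 < \<rho>\<close> zero_le_mult_iff[of \<rho> "\<theta> * ?q"] by (simp add: mult_ac)
      then have "\<theta> * ?q * (\<rho> * norm z) \<le> \<theta> * ?q * norm y"
        using gain[of z] unfolding Rz by (rule mult_left_mono[rotated])
      ultimately show ?thesis
        by (simp add: mult_ac)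
    qed
    show "norm (Q *v y) \<le> (\<alpha> + \<theta> * ?q) * norm y"
      "(\<beta> - \<theta> * ?q) * norm y \<le> norm (Q *v y)"
      using Wz upper[of z] lower[of z] norm_triangle_ineq4[of "A *v z" "W *v z"]
        norm_triangle_ineq2[of "A *v z" "W *v z"]
      unfolding Rz Qy distrib_right left_diff_distrib by linarith+
  qed
  \<comment> \<open>The norm of \<open>Q\<close> occurs on both sides because the error of the solve
    is proportional to it; \<open>\<theta> < 1\<close> allows solving for it.\<close>
  have "?q \<le> \<alpha> + \<theta> * ?q"
    by (rule spectral_norm_leI) (rule both(1))
  then show "?q \<le> \<alpha> / (1 - \<theta>)"
    using \<open>\<theta> < 1\<close> by (simp add: field_simps)
  show "(\<beta> - \<theta> * ?q) * norm y \<le> norm (Q *v y)"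
    by (rule both(2))
qed

lemma norm_mult_vec_le_of_sq:
  fixes A :: "real^'n^'m" and R :: "real^'n^'k"
  assumes "(norm (A *v z))\<^sup>2 \<le> b * (norm (R *v z))\<^sup>2" "b \<le> a\<^sup>2" "0 \<le> a"
  shows "norm (A *v z) \<le> a * norm (R *v z)"
proof (rule power2_le_imp_le)
  have "(norm (A *v z))\<^sup>2 \<le> a\<^sup>2 * (norm (R *v z))\<^sup>2"
    using assms mult_right_mono[of b "a\<^sup>2" "(norm (R *v z))\<^sup>2"] by simp
  then show "(norm (A *v z))\<^sup>2 \<le> (a * norm (R *v z))\<^sup>2"
    by (simp add: power_mult_distrib)
qed (use assms in simp)

text \<open>Once \<rho> is known to bound the gain of \<open>R\<close>, the error
  \<open>\<eta> \<rho>^2 |z|^2\<close> is at most \<open>\<eta> |R z|^2\<close>, that is, relative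
  to \<open>R z\<close>. Choosing \<rho> slightly below \<mu> leaves room for \<open>E\<close>. The
  numbers \<alpha> and \<beta> are convenient bounds for the square roots of
  \<open>1 + \<eta>\<close> and \<open>1 - \<eta>\<close>.\<close>

lemma cholesky_qr_bounds:
  fixes A Q W :: "real^'n^'m" and R :: "real^'n^'n"
  assumes RR: "transpose R ** R = transpose A ** A + E" and E: "norm E \<le> \<eta> * \<rho>\<^sup>2"
    and "0 < \<rho>" "0 \<le> \<eta>"
    and gain: "\<And>z. \<mu> * norm z \<le> norm (A *v z)" and "0 \<le> \<mu>" "\<rho>\<^sup>2 * (1 + \<eta>) \<le> \<mu>\<^sup>2"
    and QR: "Q ** R = A - W" and W: "norm W \<le> \<theta> * \<rho> * spectral_norm Q" "\<theta> < 1"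
    and \<alpha>: "1 + \<eta> \<le> \<alpha>\<^sup>2" "0 \<le> \<alpha>" and \<beta>: "\<beta>\<^sup>2 \<le> 1 - \<eta>" "0 < \<beta>"
  shows "\<rho> * norm z \<le> norm (R *v z)"
    and "spectral_norm Q \<le> \<alpha> / (1 - \<theta>)"
    and "(\<beta> - \<theta> * spectral_norm Q) * norm y \<le> norm (Q *v y)"
proof -
  have quad: "\<bar>(norm (R *v z))\<^sup>2 - (norm (A *v z))\<^sup>2\<bar> \<le> \<eta> * \<rho>\<^sup>2 * (norm z)\<^sup>2" for z
    using shifted_gram_quadratic_form[of R A 0 E z] RR mult_right_mono[OF E, of "(norm z)\<^sup>2"]
    by simp
  have low: "\<rho> * norm z \<le> norm (R *v z)" for z
  proof (rule power2_le_imp_le)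
    have "\<rho>\<^sup>2 * (1 + \<eta>) * (norm z)\<^sup>2 \<le> \<mu>\<^sup>2 * (norm z)\<^sup>2"
      using \<open>\<rho>\<^sup>2 * (1 + \<eta>) \<le> \<mu>\<^sup>2\<close> by (rule mult_right_mono) simp
    also have "\<dots> \<le> (norm (A *v z))\<^sup>2"
      using power_mono[OF gain[of z], of 2] \<open>0 \<le> \<mu>\<close> by (simp add: power_mult_distrib)
    finally show "(\<rho> * norm z)\<^sup>2 \<le> (norm (R *v z))\<^sup>2"
      using quad[of z] by (simp add: power_mult_distrib algebra_simps)
  qed simp
  have slack: "\<eta> * \<rho>\<^sup>2 * (norm z)\<^sup>2 \<le> \<eta> * (norm (R *v z))\<^sup>2" for z
    using mult_left_mono[OF power_mono[OF low[of z], of 2] \<open>0 \<le> \<eta>\<close>] \<open>0 < \<rho>\<close>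
    by (simp add: power_mult_distrib mult_ac)
  have sq: "(norm (A *v z))\<^sup>2 \<le> (1 + \<eta>) * (norm (R *v z))\<^sup>2"
    "(1 - \<eta>) * (norm (R *v z))\<^sup>2 \<le> (norm (A *v z))\<^sup>2" for z
    using quad[of z] slack[of z] unfolding distrib_right left_diff_distrib mult_1_left by linarith+
  have upper: "norm (A *v z) \<le> \<alpha> * norm (R *v z)" for z
    using sq(1) \<alpha> by (rule norm_mult_vec_le_of_sq)
  have lower: "\<beta> * norm (R *v z) \<le> norm (A *v z)" for z
  proof (rule power2_le_imp_le)
    show "(\<beta> * norm (R *v z))\<^sup>2 \<le> (norm (A *v z))\<^sup>2"
      using sq(2)[of z] mult_right_mono[OF \<beta>(1), of "(norm (R *v z))\<^sup>2"]
      by (simp add: power_mult_distrib)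
  qed simp
  show "\<rho> * norm z \<le> norm (R *v z)"
    by (rule low)
  show "spectral_norm Q \<le> \<alpha> / (1 - \<theta>)" "(\<beta> - \<theta> * spectral_norm Q) * norm y \<le> norm (Q *v y)"
    using right_solve_bounds[OF \<open>0 < \<rho>\<close> low QR W upper lower] by blast+
qed

lemma spectral_norm_factor_le:
  fixes A :: "real^'n^'m" and R :: "real^'n^'k"
  assumes RR: "transpose R ** R = transpose A ** A + s *\<^sub>R mat 1 + E"
    and "(spectral_norm A)\<^sup>2 + s + norm E \<le> b\<^sup>2" "0 \<le> b"
  shows "spectral_norm R \<le> b"
proof (rule spectral_norm_leI, rule power2_le_imp_le)
  fix z
  have "(norm (R *v z))\<^sup>2 \<le> ((spectral_norm A)\<^sup>2 + s + norm E) * (norm z)\<^sup>2"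
    using shifted_gram_quadratic_form[OF RR, of z]
      power_mono[OF norm_mult_vec_le_spectral_norm[of A z] norm_ge_zero, of 2]
    by (simp add: power_mult_distrib algebra_simps)
  also have "\<dots> \<le> b\<^sup>2 * (norm z)\<^sup>2"
    using assms(2) by (rule mult_right_mono) simp
  finally show "(norm (R *v z))\<^sup>2 \<le> (b * norm z)\<^sup>2"
    by (simp add: power_mult_distrib)
qed (use assms in simp)

subsection \<open>The three steps\<close>

text \<open>Here \<tau> stands for \<open>n^2 u\<close> and \<open>t\<close> for the square root of
  \<epsilon>: gains are linear in \<open>t\<close>, errors quadratic. The shift dominates
  \<open>E\<close>, which secures the gain of \<open>R\<close> even where that of \<open>X\<close>
  is only of order \<open>t^2\<close>.\<close>

lemma shifted_cholesky_qr_bounds: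
  fixes X Q W :: "real^'n^'m" and R E :: "real^'n^'n"
  defines "g \<equiv> max_col_norm X"
  assumes t: "0 < t" "t\<^sup>2 \<le> 1 / 1100" and "0 < g" and \<tau>: "0 \<le> \<tau>" "2 * \<tau> \<le> t\<^sup>2"
    and RR: "transpose R ** R = transpose X ** X + (11 * t\<^sup>2 * g\<^sup>2) *\<^sub>R mat 1 + E"
    and E: "norm E \<le> 10151 / 10000 * t\<^sup>2 * g\<^sup>2"
    and R: "max_col_norm R \<le> 1007 / 1000 * g"
    and gain: "\<And>z. 86 * t\<^sup>2 * g * norm z \<le> norm (X *v z)"
    and QR: "Q ** R = X - W"
    and W: "norm W \<le> 1001 / 1000 * \<tau> * (spectral_norm Q * max_col_norm R)"
  shows "spectral_norm Q \<le> 10051 / 10000" and "196 / 10 * t * norm y \<le> norm (Q *v y)"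
    and "spectral_norm R \<le> 1006 / 1000 * spectral_norm X"
proof -
  let ?q = "spectral_norm Q"
  define a where "a = t\<^sup>2"
  have a: "0 \<le> a" "a \<le> 1 / 1100"
    using t by (simp_all add: a_def)
  have t33: "t \<le> 1 / 33"
    by (rule power2_le_imp_le) (use t in \<open>simp_all add: power2_eq_square\<close>)
  have quad: "\<bar>(norm (R *v z))\<^sup>2 - ((norm (X *v z))\<^sup>2 + 11 * (a * (g\<^sup>2 * (norm z)\<^sup>2)))\<bar>
      \<le> 10151 / 10000 * (a * (g\<^sup>2 * (norm z)\<^sup>2))" for z
    using shifted_gram_quadratic_form[OF RR, of z] mult_right_mono[OF E, of "(norm z)\<^sup>2"]
    by (simp add: a_def mult_ac)
  have y0: "0 \<le> a * (g\<^sup>2 * (norm z)\<^sup>2)" for z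
    using a by simp
  \<comment> \<open>The shift less the error leaves \<open>11 - 1.0151 = 9.9849\<close>, and
    \<open>3.15^2 = 9.9225\<close>.\<close>
  define \<rho> where "\<rho> = 315 / 100 * t * g"
  have "0 < \<rho>"
    using t \<open>0 < g\<close> by (simp add: \<rho>_def)
  have low: "\<rho> * norm z \<le> norm (R *v z)" for z
  proof (rule power2_le_imp_le)
    have "(\<rho> * norm z)\<^sup>2 = 99225 / 10000 * (a * (g\<^sup>2 * (norm z)\<^sup>2))"
      by (simp add: \<rho>_def a_def power2_eq_square)
    then show "(\<rho> * norm z)\<^sup>2 \<le> (norm (R *v z))\<^sup>2"
      using quad[of z] y0[of z] zero_le_power2[of "norm (X *v z)"] by linarith
  qed simp
  have upper: "norm (X *v z) \<le> 1 * norm (R *v z)" for z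
  proof -
    have "norm (X *v z) \<le> norm (R *v z)"
    proof (rule power2_le_imp_le)
      show "(norm (X *v z))\<^sup>2 \<le> (norm (R *v z))\<^sup>2"
        using quad[of z] y0[of z] by linarith
    qed simp
    then show ?thesis
      by simp
  qed
  \<comment> \<open>This is where the constant 86 of the condition number bound enters. After
    squaring, the two contributions relative to \<open>|X z|^2\<close> are
    \<open>392.04 / 1100\<close> and \<open>392.04 * 12.0151 / 86^2\<close>, about 0.356 and 0.637,
    with sum below 1.\<close>
  have lower: "198 / 10 * t * norm (R *v z) \<le> norm (X *v z)" for z
  proof (rule power2_le_imp_le)
    define x y where "x = (norm (X *v z))\<^sup>2" and "y = a * (a * (g\<^sup>2 * (norm z)\<^sup>2))"
    have "(86 * t\<^sup>2 * g * norm z)\<^sup>2 \<le> x"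
      unfolding x_def using gain[of z] t \<open>0 < g\<close> by (intro power_mono) auto
    moreover have "(86 * t\<^sup>2 * g * norm z)\<^sup>2 = 7396 * y"
      by (simp add: a_def y_def power2_eq_square)
    ultimately have y: "7396 * y \<le> x"
      by simp
    have "a * x \<le> 1 / 1100 * x"
      using a by (intro mult_right_mono) (simp_all add: x_def)
    have Rz: "(norm (R *v z))\<^sup>2 \<le> x + 120151 / 10000 * (a * (g\<^sup>2 * (norm z)\<^sup>2))"
      using quad[of z] unfolding x_def by linarith
    have "(198 / 10 * t * norm (R *v z))\<^sup>2 = 39204 / 100 * (a * (norm (R *v z))\<^sup>2)"
      by (simp add: a_def power2_eq_square)
    also have "\<dots> \<le> 39204 / 100 * (a * (x + 120151 / 10000 * (a * (g\<^sup>2 * (norm z)\<^sup>2))))"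
      using Rz a by (intro mult_left_mono) auto
    also have "\<dots> = 39204 / 100 * (a * x) + 39204 / 100 * 120151 / 10000 * y"
      by (simp add: y_def distrib_left)
    also have "\<dots> \<le> x"
      using y \<open>a * x \<le> 1 / 1100 * x\<close> zero_le_power2[of "norm (X *v z)"]
      unfolding x_def by linarith
    finally show "(198 / 10 * t * norm (R *v z))\<^sup>2 \<le> (norm (X *v z))\<^sup>2"
      by (simp add: x_def)
  qed simp
  \<comment> \<open>Chosen so that \<open>\<theta> \<rho> = 0.50715 t^2 g\<close> exceeds
    \<open>1.001 * 1.007 * \<tau> * g\<close>, since \<tau> is at most
    \<open>t^2 / 2\<close>.\<close>
  define \<theta> where "\<theta> = 161 / 1000 * t"
  have \<theta>: "\<theta> \<le> 161 / 33000"
    using t33 by (simp add: \<theta>_def)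
  have W': "norm W \<le> \<theta> * \<rho> * ?q"
  proof -
    have "norm W \<le> 1001 / 1000 * \<tau> * (?q * (1007 / 1000 * g))"
      using R \<tau> by (intro order_trans[OF W] mult_left_mono) (auto simp: spectral_norm_nonneg)
    also have "\<dots> = 1008007 / 1000000 * \<tau> * (g * ?q)"
      by simp
    also have "\<dots> \<le> 50715 / 100000 * t\<^sup>2 * (g * ?q)"
      using \<tau> \<open>0 < g\<close> by (intro mult_right_mono) (auto simp: spectral_norm_nonneg)
    also have "\<dots> = \<theta> * \<rho> * ?q"
      by (simp add: \<theta>_def \<rho>_def power2_eq_square)
    finally show ?thesis .
  qed
  have "\<theta> < 1"
    using \<theta> by linarith
  note bounds = right_solve_bounds[OF \<open>0 < \<rho>\<close> low QR W' \<open>\<theta> < 1\<close> upper lower]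
  have "1 / (1 - \<theta>) \<le> 10051 / 10000"
    using \<theta> by (simp add: divide_le_eq)
  with bounds(1) show q: "?q \<le> 10051 / 10000"
    by linarith
  have "\<theta> * ?q \<le> \<theta> * (10051 / 10000)"
    using q t by (intro mult_left_mono) (auto simp: \<theta>_def)
  then have "196 / 10 * t \<le> 198 / 10 * t - \<theta> * ?q"
    using t unfolding \<theta>_def by linarith
  then have "196 / 10 * t * norm y \<le> (198 / 10 * t - \<theta> * ?q) * norm y"
    by (rule mult_right_mono) simp
  with bounds(2)[of y] show "196 / 10 * t * norm y \<le> norm (Q *v y)"
    by linarith
  show "spectral_norm R \<le> 1006 / 1000 * spectral_norm X"
  proof (rule spectral_norm_factor_le[OF RR])
    have "g\<^sup>2 \<le> (spectral_norm X)\<^sup>2"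
      using max_col_norm_le_spectral_norm[of X] \<open>0 < g\<close> by (intro power_mono) (auto simp: g_def)
    moreover have "a * g\<^sup>2 \<le> 1 / 1100 * g\<^sup>2"
      using a by (intro mult_right_mono) auto
    moreover have "norm E \<le> 10151 / 10000 * (a * g\<^sup>2)"
      using E by (simp add: a_def)
    ultimately have "(spectral_norm X)\<^sup>2 + 11 * (a * g\<^sup>2) + norm E
        \<le> 1012036 / 1000000 * (spectral_norm X)\<^sup>2"
      using zero_le_power2[of g] by linarith
    then show "(spectral_norm X)\<^sup>2 + 11 * t\<^sup>2 * g\<^sup>2 + norm E \<le> (1006 / 1000 * spectral_norm X)\<^sup>2"
      by (simp add: a_def power_mult_distrib power_divide)
  qed (simp add: spectral_norm_nonneg)
qed

lemma cholesky_error_le: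
  fixes A :: "real^'n^'m" and E :: "real^'n^'n"
  assumes "norm E \<le> 10151 / 10000 * e * (max_col_norm A)\<^sup>2" and "0 \<le> e"
    and "spectral_norm A \<le> a"
  shows "norm E \<le> 10151 / 10000 * e * a\<^sup>2"
proof -
  have "max_col_norm A \<le> a"
    using max_col_norm_le_spectral_norm[of A] assms(3) by linarith
  then have "(max_col_norm A)\<^sup>2 \<le> a\<^sup>2"
    by (intro power_mono) (auto simp: max_col_norm_nonneg)
  then show ?thesis
    using assms(2) by (intro order_trans[OF assms(1)] mult_left_mono) auto
qed

text \<open>Both the error \<open>E\<close> and the squared gain of \<open>A\<close> are of order
  \<open>t^2\<close>, so \<open>t\<close> cancels from their ratio: \<open>1.0256 / 19.5^2\<close>
  is below 0.0027. The step therefore brings the singular values close to 1 however small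
  \<open>t\<close> is.\<close>

lemma second_cholesky_qr_bounds:
  fixes A Q W :: "real^'n^'m" and R E :: "real^'n^'n"
  assumes t: "0 < t" "t\<^sup>2 \<le> 1 / 1100" and \<tau>: "0 \<le> \<tau>" "2 * \<tau> \<le> t\<^sup>2"
    and RR: "transpose R ** R = transpose A ** A + E"
    and E: "norm E \<le> 10151 / 10000 * t\<^sup>2 * (max_col_norm A)\<^sup>2"
    and R: "max_col_norm R \<le> 1007 / 1000 * max_col_norm A"
    and A: "spectral_norm A \<le> 10051 / 10000"
    and gain: "\<And>z. 196 / 10 * t * norm z \<le> norm (A *v z)"
    and QR: "Q ** R = A - W"
    and W: "norm W \<le> 1001 / 1000 * \<tau> * (spectral_norm Q * max_col_norm R)"
  shows "spectral_norm Q \<le> 10023 / 10000" and "9977 / 10000 * norm y \<le> norm (Q *v y)"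
    and "spectral_norm R \<le> 1006 / 1000"
proof -
  let ?q = "spectral_norm Q"
  have t33: "t \<le> 1 / 33"
    by (rule power2_le_imp_le) (use t in \<open>simp_all add: power2_eq_square\<close>)
  have "norm E \<le> 10151 / 10000 * t\<^sup>2 * (10051 / 10000)\<^sup>2"
    by (rule cholesky_error_le[OF E _ A]) simp
  also have "\<dots> \<le> 10256 / 10000 * t\<^sup>2"
    by (simp add: power2_eq_square)
  finally have E': "norm E \<le> 10256 / 10000 * t\<^sup>2" .
  define \<rho> \<theta> where "\<rho> = 195 / 10 * t" and "\<theta> = 26 / 1000 * t"
  have \<theta>: "0 \<le> \<theta>" "\<theta> \<le> 26 / 33000"
    using t t33 by (simp_all add: \<theta>_def)
  have r: "max_col_norm R \<le> 1007 / 1000 * (10051 / 10000)"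
    using R max_col_norm_le_spectral_norm[of A] A by linarith
  have W': "norm W \<le> \<theta> * \<rho> * ?q"
  proof -
    have "norm W \<le> 1001 / 1000 * \<tau> * (?q * (1007 / 1000 * (10051 / 10000)))"
      using r \<tau> by (intro order_trans[OF W] mult_left_mono) (auto simp: spectral_norm_nonneg)
    also have "\<dots> = (1001 / 1000 * (1007 / 1000 * (10051 / 10000)) * \<tau>) * ?q"
      by simp
    also have "\<dots> \<le> (507 / 1000 * t\<^sup>2) * ?q"
      using \<tau> by (intro mult_right_mono) (auto simp: spectral_norm_nonneg)
    also have "\<dots> = \<theta> * \<rho> * ?q"
      by (simp add: \<theta>_def \<rho>_def power2_eq_square)
    finally show ?thesis .
  qed
  have "0 < \<rho>"
    using t by (simp add: \<rho>_def)
  have \<rho>2: "\<rho>\<^sup>2 = 38025 / 100 * t\<^sup>2"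
    by (simp add: \<rho>_def power2_eq_square)
  have "norm E \<le> 27 / 10000 * \<rho>\<^sup>2"
    using E' zero_le_power2[of t] unfolding \<rho>2 by linarith
  moreover have "\<rho>\<^sup>2 * (1 + 27 / 10000) \<le> (196 / 10 * t)\<^sup>2"
    unfolding \<rho>2 by (simp add: power_mult_distrib power2_eq_square)
  ultimately have bounds: "?q \<le> (10014 / 10000) / (1 - \<theta>)"
    "\<And>y. (9986 / 10000 - \<theta> * ?q) * norm y \<le> norm (Q *v y)"
    using cholesky_qr_bounds[where \<eta> = "27 / 10000" and \<alpha> = "10014 / 10000" and \<beta> = "9986 / 10000",
        OF RR _ \<open>0 < \<rho>\<close> _ gain _ _ QR W'] t \<theta>
    by (auto simp: power2_eq_square)
  have "(10014 / 10000) / (1 - \<theta>) \<le> 10023 / 10000"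
    using \<theta> by (simp add: divide_le_eq)
  with bounds(1) show q: "?q \<le> 10023 / 10000"
    by linarith
  have "\<theta> * ?q \<le> 26 / 33000 * (10023 / 10000)"
    using q \<theta> by (intro mult_mono) (auto simp: spectral_norm_nonneg)
  then have "9977 / 10000 * norm y \<le> (9986 / 10000 - \<theta> * ?q) * norm y"
    by (intro mult_right_mono) auto
  with bounds(2)[of y] show "9977 / 10000 * norm y \<le> norm (Q *v y)"
    by linarith
  show "spectral_norm R \<le> 1006 / 1000"
  proof (rule spectral_norm_factor_le[where s = 0])
    have "(spectral_norm A)\<^sup>2 \<le> (10051 / 10000)\<^sup>2"
      using A by (intro power_mono) (auto simp: spectral_norm_nonneg)
    then show "(spectral_norm A)\<^sup>2 + 0 + norm E \<le> (1006 / 1000)\<^sup>2"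
      using E' t by (simp add: power2_eq_square)
  qed (use RR in auto)
qed

text \<open>The gain is now of order 1, so the errors are no longer amplified. Those of
  \<open>E\<close> and \<open>W\<close> stay expressed through \<open>e\<close> and \<tau>, as the
  final defect must be proportional to \<epsilon>.\<close>

lemma third_cholesky_qr_bounds:
  fixes A Q W :: "real^'n^'m" and R E :: "real^'n^'n"
  assumes e: "0 \<le> e" "e \<le> 1 / 1100" and \<tau>: "0 \<le> \<tau>" "2 * \<tau> \<le> e"
    and RR: "transpose R ** R = transpose A ** A + E"
    and E: "norm E \<le> 10151 / 10000 * e * (max_col_norm A)\<^sup>2"
    and R: "max_col_norm R \<le> 1007 / 1000 * max_col_norm A"
    and A: "spectral_norm A \<le> 10023 / 10000"
    and gain: "\<And>z. 9977 / 10000 * norm z \<le> norm (A *v z)"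
    and QR: "Q ** R = A - W"
    and W: "norm W \<le> 1001 / 1000 * \<tau> * (spectral_norm Q * max_col_norm R)"
  shows "spectral_norm Q \<le> 10011 / 10000" and "997 / 1000 * norm z \<le> norm (R *v z)"
    and "spectral_norm R \<le> 1003 / 1000" and "norm E \<le> 102 / 100 * e"
    and "norm W \<le> 1014 / 1000 * \<tau>"
proof -
  let ?q = "spectral_norm Q"
  have "norm E \<le> 10151 / 10000 * e * (10023 / 10000)\<^sup>2"
    by (rule cholesky_error_le[OF E e(1) A])
  also have "\<dots> \<le> 102 / 100 * e"
    using e by (simp add: power2_eq_square)
  finally show E': "norm E \<le> 102 / 100 * e" .
  define \<rho> \<theta> :: real where "\<rho> = 997 / 1000" and "\<theta> = 5 / 10000"
  have r: "max_col_norm R \<le> 1007 / 1000 * (10023 / 10000)"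
    using R max_col_norm_le_spectral_norm[of A] A by linarith
  have Wq: "norm W \<le> 1001 / 1000 * \<tau> * (?q * (1007 / 1000 * (10023 / 10000)))"
    using r \<tau> by (intro order_trans[OF W] mult_left_mono) (auto simp: spectral_norm_nonneg)
  also have "\<dots> = (1001 / 1000 * (1007 / 1000 * (10023 / 10000)) * \<tau>) * ?q"
    by simp
  also have "\<dots> \<le> (\<theta> * \<rho>) * ?q"
    using \<tau> e by (intro mult_right_mono) (auto simp: spectral_norm_nonneg \<theta>_def \<rho>_def)
  finally have W': "norm W \<le> \<theta> * \<rho> * ?q" .
  have "norm E \<le> 94 / 100000 * \<rho>\<^sup>2"
    using E' e by (simp add: \<rho>_def power2_eq_square)
  moreover have "\<rho>\<^sup>2 * (1 + 94 / 100000) \<le> (9977 / 10000)\<^sup>2"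
    by (simp add: \<rho>_def power2_eq_square)
  ultimately have bounds: "\<And>z. \<rho> * norm z \<le> norm (R *v z)" "?q \<le> (10005 / 10000) / (1 - \<theta>)"
    using cholesky_qr_bounds[where \<eta> = "94 / 100000" and \<alpha> = "10005 / 10000" and \<beta> = "9995 / 10000",
        OF RR _ _ _ gain _ _ QR W']
    by (auto simp: power2_eq_square \<rho>_def \<theta>_def)
  show "997 / 1000 * norm z \<le> norm (R *v z)"
    using bounds(1) by (simp add: \<rho>_def)
  show q: "?q \<le> 10011 / 10000"
    using bounds(2) by (simp add: \<theta>_def)
  show "spectral_norm R \<le> 1003 / 1000"
  proof (rule spectral_norm_factor_le[where s = 0])
    have "(spectral_norm A)\<^sup>2 \<le> (10023 / 10000)\<^sup>2"
      using A by (intro power_mono) (auto simp: spectral_norm_nonneg)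
    then show "(spectral_norm A)\<^sup>2 + 0 + norm E \<le> (1003 / 1000)\<^sup>2"
      using E' e by (simp add: power2_eq_square)
  qed (use RR in auto)
  have "1001 / 1000 * \<tau> * (?q * (1007 / 1000 * (10023 / 10000)))
      \<le> 1001 / 1000 * \<tau> * (10011 / 10000 * (1007 / 1000 * (10023 / 10000)))"
    using q \<tau> by (intro mult_left_mono mult_right_mono) auto
  then show "norm W \<le> 1014 / 1000 * \<tau>"
    using Wq \<tau> by simp
qed

section \<open>Orthogonality defect and residual\<close>

lemma matrix_diff_ldistrib: "A ** (B - C) = A ** B - A ** C"
  for A :: "real^'n^'m" and B C :: "real^'k^'n"
  by (simp add: matrix_matrix_mult_def vec_eq_iff right_diff_distrib sum_subtractf)

lemma matrix_diff_rdistrib: "(A - B) ** C = A ** C - B ** C"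
  for A B :: "real^'n^'m" and C :: "real^'k^'n"
  by (simp add: matrix_matrix_mult_def vec_eq_iff left_diff_distrib sum_subtractf)

text \<open>After congruence with \<open>R\<close>, the defect becomes
  \<open>(A - W)^T (A - W) - R^T R\<close>, in which \<open>A^T A\<close> cancels and only terms
  containing \<open>W\<close> or \<open>E\<close> survive.\<close>

lemma orthogonality_defect:
  fixes A Q W :: "real^'n^'m" and R E :: "real^'n^'n"
  assumes "0 < \<rho>" and gain: "\<And>z. \<rho> * norm z \<le> norm (R *v z)"
    and RR: "transpose R ** R = transpose A ** A + E" and QR: "Q ** R = A - W"
  shows "\<rho>\<^sup>2 * norm (transpose Q ** Q - mat 1)
           \<le> (norm W)\<^sup>2 + 2 * spectral_norm A * norm W + norm E"
proof -
  have eq: "transpose R ** (transpose Q ** Q - mat 1) ** R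
      = transpose W ** W - transpose A ** W - transpose W ** A - E"
  proof -
    have "transpose R ** (transpose Q ** Q - mat 1) ** R
        = transpose (Q ** R) ** (Q ** R) - transpose R ** R"
      by (simp add: matrix_transpose_mul matrix_mul_assoc matrix_diff_ldistrib matrix_diff_rdistrib)
    also have "\<dots> = transpose W ** W - transpose A ** W - transpose W ** A - E"
      unfolding QR RR transpose_diff
      by (simp add: matrix_diff_ldistrib matrix_diff_rdistrib)
    finally show ?thesis .
  qed
  have 1: "norm (transpose W ** W) \<le> (norm W)\<^sup>2"
    using norm_mult_le_left[of "transpose W" W]
      mult_right_mono[OF spectral_norm_le_norm[of "transpose W"], of "norm W"]
    by (simp add: norm_transpose power2_eq_square)
  have 2: "norm (transpose A ** W) \<le> spectral_norm A * norm W"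
    using norm_mult_le_left[of "transpose A" W]
      mult_right_mono[OF spectral_norm_transpose_le[of A], of "norm W"]
    by simp
  have 3: "norm (transpose W ** A) \<le> spectral_norm A * norm W"
    using norm_mult_le_right[of "transpose W" A] by (simp add: norm_transpose mult.commute)
  have "\<rho>\<^sup>2 * norm (transpose Q ** Q - mat 1)
      \<le> norm (transpose W ** W - transpose A ** W - transpose W ** A - E)"
    using norm_congruence_ge[OF assms(1,2), of "transpose Q ** Q - mat 1"] by (simp only: eq)
  also have "\<dots> \<le> norm (transpose W ** W) + norm (transpose A ** W) + norm (transpose W ** A) + norm E"
    by (intro order_trans[OF norm_triangle_ineq4] add_mono order_refl)
  finally show ?thesis
    using 1 2 3 by linarith
qed

lemma spectral_norm_perturbed_product_le:
  fixes A :: "real^'n^'m" and B :: "real^'k^'n"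
  shows "spectral_norm (A ** B - E) \<le> spectral_norm A * spectral_norm B + norm E"
proof (rule spectral_norm_leI)
  fix z
  have "norm ((A ** B - E) *v z) \<le> norm (A *v (B *v z)) + norm (E *v z)"
    by (simp add: matrix_vector_mult_diff_rdistrib matrix_vector_mul_assoc norm_triangle_ineq4)
  also have "norm (A *v (B *v z)) \<le> spectral_norm A * (spectral_norm B * norm z)"
    using norm_mult_vec_le_spectral_norm[of A "B *v z"]
      mult_left_mono[OF norm_mult_vec_le_spectral_norm[of B z] spectral_norm_nonneg[of A]]
    by linarith
  also have "norm (E *v z) \<le> norm E * norm z"
    by (rule norm_mult_vec_le_norm)
  finally show "norm ((A ** B - E) *v z) \<le> (spectral_norm A * spectral_norm B + norm E) * norm z"
    by (simp add: algebra_simps)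
qed

text \<open>The analogue for column norms keeps the bound on \<open>R2\<close> proportional to
  \<open>[X]_g\<close>, so that the error of the last product contributes to the term with
  \<open>p\<close>.\<close>

lemma max_col_norm_perturbed_product_le:
  fixes A :: "real^'n^'m" and B :: "real^'k^'n"
  shows "max_col_norm (A ** B - E) \<le> spectral_norm A * max_col_norm B + norm E"
proof (rule max_col_norm_leI)
  fix j
  have "column j (A ** B - E) = A *v column j B - column j E"
    unfolding column_mult[symmetric] by (simp add: vec_eq_iff column_def)
  then have "norm (column j (A ** B - E)) \<le> norm (A *v column j B) + norm (column j E)"
    by (simp add: norm_triangle_ineq4)
  also have "norm (A *v column j B) \<le> spectral_norm A * max_col_norm B"
    using norm_mult_vec_le_spectral_norm[of A "column j B"]
      mult_left_mono[OF norm_column_le_max_col_norm[of j B] spectral_norm_nonneg[of A]]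
    by linarith
  also have "norm (column j E) \<le> norm E"
    using norm_column_le_max_col_norm[of j E] max_col_norm_le_spectral_norm[of E]
      spectral_norm_le_norm[of E] by linarith
  finally show "norm (column j (A ** B - E)) \<le> spectral_norm A * max_col_norm B + norm E"
    by simp
qed

text \<open>Unfolding the factors from the outside in telescopes the product to \<open>X\<close>,
  leaving one error term per operation.\<close>

lemma three_step_residual:
  fixes X Q Q1 Q2 W W1 W2 :: "real^'n^'m" and R R1 R2 R3 R4 E4 E8 :: "real^'n^'n"
  assumes "Q ** R = X - W" "Q1 ** R1 = Q - W1" "Q2 ** R3 = Q1 - W2"
    and "R2 = R1 ** R - E4" "R4 = R3 ** R2 - E8"
  shows "norm (Q2 ** R4 - X) \<le> norm W + norm W1 * spectral_norm R + spectral_norm Q1 * norm E4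
           + norm W2 * spectral_norm R2 + spectral_norm Q2 * norm E8"
proof -
  have "Q2 ** R4 = (Q2 ** R3) ** R2 - Q2 ** E8"
    by (simp add: assms(5) matrix_diff_ldistrib matrix_mul_assoc)
  also have "\<dots> = Q1 ** R2 - W2 ** R2 - Q2 ** E8"
    by (simp add: assms(3) matrix_diff_rdistrib)
  also have "Q1 ** R2 = (Q1 ** R1) ** R - Q1 ** E4"
    by (simp add: assms(4) matrix_diff_ldistrib matrix_mul_assoc)
  also have "\<dots> = X - W - W1 ** R - Q1 ** E4"
    by (simp add: assms(1,2) matrix_diff_rdistrib)
  finally have "Q2 ** R4 - X = - (W + W1 ** R + Q1 ** E4 + W2 ** R2 + Q2 ** E8)"
    by simp
  then have "norm (Q2 ** R4 - X) = norm (W + W1 ** R + Q1 ** E4 + W2 ** R2 + Q2 ** E8)"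
    by (simp only: norm_minus_cancel)
  also have "\<dots> \<le> norm W + norm (W1 ** R) + norm (Q1 ** E4) + norm (W2 ** R2) + norm (Q2 ** E8)"
    by (intro order_trans[OF norm_triangle_ineq] add_mono order_refl)
  finally show ?thesis
    using norm_mult_le_right[of W1 R] norm_mult_le_left[of Q1 E4] norm_mult_le_right[of W2 R2]
      norm_mult_le_left[of Q2 E8] by linarith
qed

lemma max_col_norm_pos:
  fixes A :: "real^'n^'m"
  assumes "A \<noteq> 0"
  shows "0 < max_col_norm A"
proof -
  have "0 < norm A"
    using assms by simp
  also have "\<dots> \<le> sqrt CARD('n) * max_col_norm A"
    by (rule norm_le_max_col_norm)
  finally show ?thesis
    by (simp add: zero_less_mult_iff)
qed

section \<open>Error bounds for the computed factors\<close>

theorem theorem3: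
  fixes X :: "real^('n::{finite,linorder})^'m"
    and Q2 :: "real^('n::{finite,linorder})^'m"
    and R4 :: "real^('n::{finite,linorder})^('n::{finite,linorder})"
    and m n :: nat and u p s :: real
  assumes m_def: "m = CARD('m)" and n_def: "n = CARD('n)" and u_def: "u = unit_roundoff"
    and p_def: "p = max_col_norm X / spectral_norm X"
    and m_ge_n: "m \<ge> n"
    and full_rank: "rank X = n"
    and mn_small: "real m * real n * u \<le> 1 / 64"
    and nn_small: "real n * (real n + 1) * u \<le> 1 / 64"
    and s_def: "s = 11 * (real m * real n * u + real n * (real n + 1) * u) * (max_col_norm X)\<^sup>2"
    and s_small: "s \<le> 1 / 100 * (max_col_norm X)\<^sup>2"
    and cond: "cond2 X \<le> 1 / (86 * p * (real m * real n * u + real n * (real n + 1) * u))"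
    and computed: "improved_SCholeskyQR3 s X Q2 R4"
  shows "1 / (86 * p * (real m * real n * u + real n * (real n + 1) * u))
           \<le> 1 / (4.89 * p * (real n)\<^sup>2 * u) \<and>
         frobenius_norm (transpose Q2 ** Q2 - mat 1)
           \<le> 6 * (real m * real n * u + real n * (real n + 1) * u) \<and>
         frobenius_norm (Q2 ** R4 - X)
           \<le> (6.57 * p + 4.87) * (real n)\<^sup>2 * u * spectral_norm X"
proof -
  define \<epsilon> where "\<epsilon> = real m * real n * u + real n * (real n + 1) * u"
  define \<tau> where "\<tau> = (real n)\<^sup>2 * u"
  define g where "g = max_col_norm X"
  define N where "N = spectral_norm X"
  define t where "t = sqrt \<epsilon>"
  have u: "0 < u"
    by (simp add: u_def unit_roundoff_pos)
  have n1: "1 \<le> real n"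
    by (simp add: n_def one_le_CARD)
  have \<tau>0: "0 < \<tau>"
    using u n1 by (simp add: \<tau>_def)
  \<comment> \<open>As \<open>m \<ge> n\<close>, each of \<open>m n\<close> and
    \<open>n (n + 1)\<close> is at least \<open>n^2\<close>.\<close>
  have \<tau>\<epsilon>: "2 * \<tau> \<le> \<epsilon>"
  proof -
    have "real n * real n * u \<le> real m * real n * u"
      using m_ge_n u by (intro mult_right_mono) auto
    moreover have "\<epsilon> = real m * real n * u + real n * real n * u + real n * u"
      by (simp add: \<epsilon>_def algebra_simps)
    moreover have "0 \<le> real n * u" and "\<tau> = real n * real n * u"
      using u by (simp_all add: \<tau>_def power2_eq_square)
    ultimately show ?thesis
      by linarith
  qed
  have "X \<noteq> 0"
    using full_rank n1 by auto
  then have g0: "0 < g"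
    by (simp add: g_def max_col_norm_pos)
  have gN: "g \<le> N"
    by (simp add: g_def N_def max_col_norm_le_spectral_norm)
  have N0: "0 < N"
    using g0 gN by linarith
  have pN: "p * N = g" and p0: "0 < p"
    using N0 g0 by (simp_all add: p_def g_def N_def)
  have \<epsilon>: "0 < \<epsilon>" "\<epsilon> \<le> 1 / 1100"
  proof -
    show "0 < \<epsilon>"
      using \<tau>0 \<tau>\<epsilon> by linarith
    have "(11 * \<epsilon>) * g\<^sup>2 \<le> 1 / 100 * g\<^sup>2"
      using s_small unfolding s_def \<epsilon>_def g_def .
    then show "\<epsilon> \<le> 1 / 1100"
      using g0 by simp
  qed
  have t: "0 < t" "t\<^sup>2 = \<epsilon>"
    using \<epsilon> by (simp_all add: t_def)
  have \<tau>': "0 \<le> \<tau>" "2 * \<tau> \<le> t\<^sup>2" and t': "t\<^sup>2 \<le> 1 / 1100"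
    using \<tau>0 \<tau>\<epsilon> \<epsilon> t by simp_all
  have eps: "real CARD('m) * real CARD('n) * unit_roundoff
      + real CARD('n) * (real CARD('n) + 1) * unit_roundoff \<le> t\<^sup>2"
    unfolding t(2) by (simp add: \<epsilon>_def m_def n_def u_def)
  have nu: "real CARD('n) * unit_roundoff \<le> 1 / 1100"
  proof -
    have "real n * u \<le> \<tau>"
      using n1 u mult_right_mono[of 1 "real n" "real n * u"] by (simp add: \<tau>_def power2_eq_square)
    then show ?thesis
      using \<tau>\<epsilon> \<tau>0 \<epsilon> by (simp add: n_def u_def)
  qed
  have \<tau>_eq: "(real CARD('n))\<^sup>2 * unit_roundoff = \<tau>"
    by (simp add: \<tau>_def n_def u_def)
  \<comment> \<open>The identity \<open>p * N = g\<close> converts the condition number bound into a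
    gain in terms of \<open>[X]_g\<close>.\<close>
  have gain: "86 * t\<^sup>2 * g * norm z \<le> norm (X *v z)" for z
  proof -
    have "N * norm z \<le> cond2 X * norm (X *v z)"
      unfolding N_def using full_rank by (intro spectral_norm_le_cond2_mult) (simp add: n_def)
    also have "\<dots> \<le> 1 / (86 * p * \<epsilon>) * norm (X *v z)"
      using cond by (intro mult_right_mono) (auto simp: \<epsilon>_def)
    finally have "86 * p * \<epsilon> * (N * norm z) \<le> norm (X *v z)"
      using p0 \<epsilon>(1) by (simp add: field_simps)
    moreover have "86 * p * \<epsilon> * (N * norm z) = 86 * t\<^sup>2 * g * norm z"
      by (simp add: t(2) flip: pN)
    ultimately show ?thesis
      by simp
  qed
  obtain B R Q C R1 Q1 R2 C1 R3 where
      gram: "fl_gram X B" "fl_gram Q C" "fl_gram Q1 C1" and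
      chol: "fl_cholesky (B + s *\<^sub>R mat 1) R" "fl_cholesky C R1" "fl_cholesky C1 R3" and
      solve: "fl_right_solve X R Q" "fl_right_solve Q R1 Q1" "fl_right_solve Q1 R3 Q2" and
      mult: "fl_mult R1 R R2" "fl_mult R3 R2 R4"
    using computed unfolding improved_SCholeskyQR3_def by metis
  obtain E where E: "transpose R ** R = transpose X ** X + s *\<^sub>R mat 1 + E"
      "norm E \<le> 10151 / 10000 * t\<^sup>2 * (max_col_norm X)\<^sup>2"
    and R: "max_col_norm R \<le> 1007 / 1000 * max_col_norm X"
    using fl_gram_cholesky_error[OF eps t' gram(1) chol(1)] s_small by auto
  obtain E1 where E1: "transpose R1 ** R1 = transpose Q ** Q + E1"
      "norm E1 \<le> 10151 / 10000 * t\<^sup>2 * (max_col_norm Q)\<^sup>2"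
    and R1: "max_col_norm R1 \<le> 1007 / 1000 * max_col_norm Q"
    using fl_gram_cholesky_error[OF eps t' gram(2), of 0 R1] chol(2) by auto
  obtain E5 where E5: "transpose R3 ** R3 = transpose Q1 ** Q1 + E5"
      "norm E5 \<le> 10151 / 10000 * t\<^sup>2 * (max_col_norm Q1)\<^sup>2"
    and R3: "max_col_norm R3 \<le> 1007 / 1000 * max_col_norm Q1"
    using fl_gram_cholesky_error[OF eps t' gram(3), of 0 R3] chol(3) by auto
  note error_le = fl_mult_norm_error_le[OF nu, unfolded \<tau>_eq]
  obtain W where W: "Q ** R = X - W"
      "norm W \<le> 1001 / 1000 * \<tau> * (spectral_norm Q * max_col_norm R)"
    using fl_right_solve_residual[OF solve(1)] error_le by metis
  obtain W1 where W1: "Q1 ** R1 = Q - W1"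
      "norm W1 \<le> 1001 / 1000 * \<tau> * (spectral_norm Q1 * max_col_norm R1)"
    using fl_right_solve_residual[OF solve(2)] error_le by metis
  obtain W2 where W2: "Q2 ** R3 = Q1 - W2"
      "norm W2 \<le> 1001 / 1000 * \<tau> * (spectral_norm Q2 * max_col_norm R3)"
    using fl_right_solve_residual[OF solve(3)] error_le by metis
  obtain E4 where E4: "R2 = R1 ** R - E4"
      "norm E4 \<le> 1001 / 1000 * \<tau> * (spectral_norm R1 * max_col_norm R)"
    using mult(1) error_le unfolding fl_mult_def by metis
  obtain E8 where E8: "R4 = R3 ** R2 - E8"
      "norm E8 \<le> 1001 / 1000 * \<tau> * (spectral_norm R3 * max_col_norm R2)"
    using mult(2) error_le unfolding fl_mult_def by metis
  have E': "transpose R ** R = transpose X ** X + (11 * t\<^sup>2 * (max_col_norm X)\<^sup>2) *\<^sub>R mat 1 + E"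
    using E(1) by (simp add: s_def t(2) \<epsilon>_def)
  have gain': "86 * t\<^sup>2 * max_col_norm X * norm z \<le> norm (X *v z)" for z
    using gain by (simp add: g_def)
  note step1 = shifted_cholesky_qr_bounds[OF t(1) t' g0[unfolded g_def] \<tau>' E' E(2) R gain' W]
  note step2 = second_cholesky_qr_bounds[OF t(1) t' \<tau>' E1 R1 step1(1,2) W1]
  note step3 = third_cholesky_qr_bounds[OF zero_le_power2 t' \<tau>' E5 R3 step2(1,2) W2]
  have p1: "1 / (86 * p * \<epsilon>) \<le> 1 / (4.89 * p * (real n)\<^sup>2 * u)"
  proof (rule divide_left_mono)
    have "4.89 * \<tau> \<le> 86 * \<epsilon>"
      using \<tau>\<epsilon> \<tau>0 by simp
    from mult_left_mono[OF this, of p] show "4.89 * p * (real n)\<^sup>2 * u \<le> 86 * p * \<epsilon>"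
      using p0 by (simp add: \<tau>_def mult_ac)
    show "0 < 86 * p * \<epsilon> * (4.89 * p * (real n)\<^sup>2 * u)"
      using p0 \<epsilon> u n1 by simp
  qed simp
  have p2: "norm (transpose Q2 ** Q2 - mat 1) \<le> 6 * \<epsilon>"
  proof -
    let ?D = "norm (transpose Q2 ** Q2 - mat 1)" and ?w = "norm W2"
    have w: "?w \<le> 507 / 1000 * \<epsilon>"
      using step3(5) \<tau>\<epsilon> by linarith
    have "(997 / 1000)\<^sup>2 * ?D \<le> ?w\<^sup>2 + 2 * spectral_norm Q1 * ?w + norm E5"
      using orthogonality_defect[OF _ step3(2) E5(1) W2(1)] by simp
    \<comment> \<open>Coarse estimates suffice: the right-hand side ends up at most
      \<open>4 * 0.507 + 1.02 = 3.048\<close> times \<epsilon>, well below 6.\<close>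
    also have "?w\<^sup>2 \<le> 1 * ?w"
      unfolding power2_eq_square using w \<epsilon> by (intro mult_right_mono) auto
    also have "2 * spectral_norm Q1 * ?w \<le> 3 * ?w"
      using step2(1) by (intro mult_right_mono) auto
    finally have "994009 / 1000000 * ?D \<le> 4 * ?w + norm E5"
      by (simp add: power2_eq_square)
    then show ?thesis
      using w step3(4) \<epsilon> unfolding t(2) by linarith
  qed
  \<comment> \<open>\<open>W\<close>, \<open>E4\<close> and \<open>E8\<close> inherit column norms
    proportional to \<open>g\<close> and contribute \<open>1.1 + 1.2 + 1.3\<close>.
    \<open>W1\<close> and \<open>W2\<close> are multiplied by the spectral norms of \<open>R\<close>
    and \<open>R2\<close>, hence by \<open>N\<close>, and contribute
    \<open>1.2 + 1.2\<close>.\<close>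
  have p3: "norm (Q2 ** R4 - X) \<le> 657 / 100 * (\<tau> * g) + 487 / 100 * (\<tau> * N)"
  proof -
    have err: "1001 / 1000 * \<tau> * (x * y) \<le> 1001 / 1000 * \<tau> * (x' * y')"
      if "x \<le> x'" "y \<le> y'" "0 \<le> x'" "0 \<le> y" for x x' y y'
      using that \<tau>0 by (intro mult_left_mono mult_mono) auto
    note nonneg = spectral_norm_nonneg max_col_norm_nonneg
    have Rg: "max_col_norm R \<le> 1007 / 1000 * g" and RN: "spectral_norm R \<le> 1006 / 1000 * N"
      using R step1(3) by (simp_all add: g_def N_def)
    have \<tau>g: "0 \<le> \<tau> * g" and \<tau>N: "0 \<le> \<tau> * N"
      using \<tau>0 g0 N0 by simp_all
    have \<tau>g': "\<tau> * g \<le> 1 / 2200 * g"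
      using \<tau>\<epsilon> \<epsilon> g0 by (intro mult_right_mono) auto
    have "norm W \<le> 1001 / 1000 * \<tau> * (10051 / 10000 * (1007 / 1000 * g))"
      using Rg step1(1) by (intro order_trans[OF W(2)] err) (simp_all add: nonneg)
    also have "\<dots> \<le> 11 / 10 * (\<tau> * g)"
      using \<tau>g by simp
    finally have w: "norm W \<le> 11 / 10 * (\<tau> * g)" .
    have "max_col_norm R1 \<le> 1007 / 1000 * (10051 / 10000)"
      using R1 max_col_norm_le_spectral_norm[of Q] step1(1) by linarith
    then have "norm W1 \<le> 1001 / 1000 * \<tau> * (10023 / 10000 * (1007 / 1000 * (10051 / 10000)))"
      using step2(1) by (intro order_trans[OF W1(2)] err) (simp_all add: nonneg)
    also have "\<dots> \<le> 11 / 10 * \<tau>"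
      using \<tau>0 by simp
    finally have "norm W1 * spectral_norm R \<le> 11 / 10 * \<tau> * (1006 / 1000 * N)"
      using RN \<tau>0 by (intro mult_mono) (simp_all add: nonneg)
    then have w1: "norm W1 * spectral_norm R \<le> 12 / 10 * (\<tau> * N)"
      using \<tau>N by simp
    have "norm E4 \<le> 1001 / 1000 * \<tau> * (1006 / 1000 * (1007 / 1000 * g))"
      using Rg step2(3) by (intro order_trans[OF E4(2)] err) (simp_all add: nonneg)
    also have "\<dots> \<le> 11 / 10 * (\<tau> * g)"
      using \<tau>g by simp
    finally have e4: "norm E4 \<le> 11 / 10 * (\<tau> * g)" .
    then have "spectral_norm Q1 * norm E4 \<le> 10023 / 10000 * (11 / 10 * (\<tau> * g))"
      using step2(1) by (intro mult_mono) simp_all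
    then have q1e4: "spectral_norm Q1 * norm E4 \<le> 12 / 10 * (\<tau> * g)"
      using \<tau>g by simp
    have "spectral_norm R1 * spectral_norm R \<le> 1006 / 1000 * (1006 / 1000 * N)"
      using step2(3) RN by (intro mult_mono) (simp_all add: nonneg)
    \<comment> \<open>The rounding error \<open>E4\<close> is absorbed through
      \<open>\<tau> \<le> 1/2200\<close> and \<open>g \<le> N\<close>.\<close>
    then have R2N: "spectral_norm R2 \<le> 11 / 10 * N"
      using spectral_norm_perturbed_product_le[of R1 R E4] e4 \<tau>g' gN N0 unfolding E4(1)
      by linarith
    have "norm W2 * spectral_norm R2 \<le> (1014 / 1000 * \<tau>) * (11 / 10 * N)"
      using R2N step3(5) \<tau>0 by (intro mult_mono) (simp_all add: nonneg)
    then have w2: "norm W2 * spectral_norm R2 \<le> 12 / 10 * (\<tau> * N)"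
      using \<tau>N by simp
    have "spectral_norm R1 * max_col_norm R \<le> 1006 / 1000 * (1007 / 1000 * g)"
      using step2(3) Rg by (intro mult_mono) (simp_all add: nonneg)
    then have R2g: "max_col_norm R2 \<le> 11 / 10 * g"
      using max_col_norm_perturbed_product_le[of R1 R E4] e4 \<tau>g' g0 unfolding E4(1)
      by linarith
    have "norm E8 \<le> 1001 / 1000 * \<tau> * (1003 / 1000 * (11 / 10 * g))"
      using R2g step3(3) by (intro order_trans[OF E8(2)] err) (simp_all add: nonneg)
    also have "\<dots> \<le> 12 / 10 * (\<tau> * g)"
      using \<tau>g by simp
    finally have "norm E8 \<le> 12 / 10 * (\<tau> * g)" .
    then have "spectral_norm Q2 * norm E8 \<le> 10011 / 10000 * (12 / 10 * (\<tau> * g))"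
      using step3(1) by (intro mult_mono) simp_all
    then have q2e8: "spectral_norm Q2 * norm E8 \<le> 13 / 10 * (\<tau> * g)"
      using \<tau>g by simp
    show ?thesis
      using three_step_residual[OF W(1) W1(1) W2(1) E4(1) E8(1)] w w1 q1e4 w2 q2e8 \<tau>g \<tau>N
      by linarith
  qed
  have "657 / 100 * (\<tau> * g) + 487 / 100 * (\<tau> * N) = (6.57 * p + 4.87) * (real n)\<^sup>2 * u * N"
    by (simp add: \<tau>_def algebra_simps flip: pN)
  with p1 p2 p3 show ?thesis
    unfolding \<epsilon>_def N_def by simp
qed

end
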